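(* Let $C_0=e^{W(1/e)}$ ($\approx 1.3211$). For every log-concave real random variable $X$ and all real $p>q\geq 2$, $$\|X\|_p\leq C_0\,\frac{p}{q}\,\|X\|_q .$$ Moreover, $C_0$ is the least such constant independent of $p,q$: if $C$ is a real number such that $\|X\|_p\leq C\frac{p}{q}\|X\|_q$ for every log-concave real random variable $X$ and all $p>q\geq 2$, then $C\geq C_0$.
   Context: A real random variable $X$ is called log-concave if either $X$ is constant almost surely, or $X$ has a density (with respect to Lebesgue measure) of the form $e^{-V}$ with $V:\mathbb{R}\to\mathbb{R}\cup\{+\infty\}$ convex. For $s>0$, $\|X\|_s=(\mathbb{E}|X|^s)^{1/s}$. $W$ is the Lambert function on the positive reals, i.e. the inverse of $x\mapsto xe^x$; thus $W(1/e)$ is the unique $w>0$ with $we^w=1/e$. *)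

theory Defs
  imports "HOL-Probability.Probability"
begin

text \<open>On the extended reals $0 \cdot \infty = 0$, so the cases $t = 0$ and $t = 1$ are trivial
  even when $V$ takes the value $\infty$.\<close>

definition extended_convex :: "(real \<Rightarrow> ereal) \<Rightarrow> bool" where
  "extended_convex V \<longleftrightarrow>
     (\<forall>x. V x \<noteq> -\<infinity>) \<and>
     (\<forall>x y t. 0 \<le> t \<and> t \<le> 1 \<longrightarrow>
        V ((1 - t) * x + t * y) \<le> ereal (1 - t) * V x + ereal t * V y)"

text \<open>The function $e^{-V}$, with $e^{-\infty} = 0$.\<close>

definition exp_neg :: "ereal \<Rightarrow> ennreal" where
  "exp_neg v = (if v = \<infinity> then 0 else ennreal (exp (- real_of_ereal v)))"

definition log_concave_rv :: "'a measure \<Rightarrow> ('a \<Rightarrow> real) \<Rightarrow> bool" where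
  "log_concave_rv M X \<longleftrightarrow>
     X \<in> borel_measurable M \<and>
     ((\<exists>c. AE \<omega> in M. X \<omega> = c) \<or>
      (\<exists>V. extended_convex V \<and> distributed M lborel X (\<lambda>x. exp_neg (V x))))"

text \<open>The value is $\infty$ when $E|X|^s$ is infinite; hence the Lebesgue integral of
  nonnegative functions is used instead of the Bochner integral, which would be 0.\<close>

definition L_norm :: "'a measure \<Rightarrow> real \<Rightarrow> ('a \<Rightarrow> real) \<Rightarrow> ereal" where
  "L_norm M s X =
     (let I = (\<integral>\<^sup>+ \<omega>. ennreal (\<bar>X \<omega>\<bar> powr s) \<partial>M)
      in if I = \<infinity> then \<infinity> else ereal (enn2real I powr (1 / s)))"

definition lambert_W :: "real \<Rightarrow> real" where
  "lambert_W = the_inv_into {0<..} (\<lambda>x. x * exp x)"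

definition C0 :: real where
  "C0 = exp (lambert_W (1 / exp 1))"

end

theory Submission
  imports Defs "HOL-Real_Asymp.Real_Asymp"
begin

text \<open>Split $X$ at $0$ and write $m = P(X > 0)$. On $(0,\infty)$ the log-concave density $f$ is
  compared with the exponential density $g(x) = m \mu e^{-\mu x}$ having the same mass and the same
  $q$-th moment. Since $\log f - \log g$ is concave, $f - g$ changes sign in the pattern $-,+,-$ on
  $(0,\infty)$; hence the $p$-th moment of $f$ there is at most that of $g$, and moreover $f \le g$ on
  $(-\infty, 0]$. The latter forces the mass $1 - m$ of the negative side to lie far from $0$ when $m$
  is small, so that with $w = W(1/e)$
  \[ E[X_+^q]/m \le e^{wq-1}\, S(q)\, E|X|^q, \qquad S(s) = \Gamma(s+1)(e/s)^s . \]
  The same holds for $-X$, and interpolation from $q$ to $p$ reduces the bound to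
  $S(p)/S(q) \le p/q \le e^{p/q-1}$. For the optimality, take $X$ exponential shifted by $wq$,
  $p = q^2$, and let $q \to \infty$.\<close>

section \<open>The Gamma function relative to Stirling's approximation\<close>


text \<open>The obstacle is a small mass m. On the positive side interpolation only gives a multiple
  of m (E[X_+^q]/m)^(p/q), so E[X_+^q]/m itself has to be bounded by E|X|^q, although X need not be
  centred. The constant is the balance point. Put a = -ln m. If the rest of the mass, m (e^a - 1),
  sits as close to 0 as the bound f <= g allows, it fills [-a/\<mu>, 0], mostly near the far end. Up
  to factors that are subexponential in q, the two sides then contribute e^(-a) (q/e)^q and a^q,
  each times \<mu>^(-q), to E|X|^q; for a = wq these agree exactly when w e^w = 1/e. For smaller a
  the factor 1/m = e^a is at most e^(wq); for larger a the far side makes E|X|^q large enough.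

  In the final bound the p-th root of e^(wq(p/q - 1)) is e^(w(1 - q/p)), so e^w is reached only in
  the limit p/q -> \<infinity>. This is why the extremal family takes p/q = q unbounded; q ->
  \<infinity> also makes the q-th roots of polynomial factors disappear.\<close>

lemma Digamma_le_ln_le_Digamma:
  fixes x :: real
  assumes "x > 0"
  shows "Digamma x \<le> ln x" "ln x \<le> Digamma (x + 1)"
proof -
  have D: "((\<lambda>y. ln (Gamma y)) has_real_derivative Digamma y) (at y)" if "y > 0" for y :: real
    using that Gamma_real_pos[OF that]
    by (auto intro!: derivative_eq_intros dest: nonpos_Ints_nonpos simp: less_le)
  \<comment> \<open>The mean value theorem for \<open>ln Gamma\<close> on [x, x + 1]: the functional
    equation makes the increment equal to \<open>ln x\<close>, so \<open>ln x\<close> is a value of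
    the increasing function \<open>Digamma\<close> between the two ends.\<close>
  obtain z where z: "x < z" "z < x + 1"
      "ln (Gamma (x + 1)) - ln (Gamma x) = (x + 1 - x) * Digamma z"
    using MVT2[of x "x + 1" "\<lambda>y. ln (Gamma y)" Digamma] D assms by force
  have "Gamma (x + 1) = x * Gamma x"
    using assms by (intro Gamma_plus1) (auto dest: nonpos_Ints_nonpos)
  then have "ln (Gamma (x + 1)) = ln x + ln (Gamma x)"
    using assms Gamma_real_pos[of x] by (simp add: ln_mult less_le)
  then have "ln x = Digamma z" using z by simp
  then show "Digamma x \<le> ln x" "ln x \<le> Digamma (x + 1)"
    using z assms by (auto intro: Digamma_real_mono)
qed

definition stirling_ratio :: "real \<Rightarrow> real" where
  "stirling_ratio s = Gamma (s + 1) / (s / exp 1) powr s"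

lemma Gamma_eq_stirling_ratio:
  "s > 0 \<Longrightarrow> Gamma (s + 1) = stirling_ratio s * (s / exp 1) powr s"
  by (simp add: stirling_ratio_def)

lemma stirling_ratio_pos: "s > 0 \<Longrightarrow> stirling_ratio s > 0"
  by (simp add: stirling_ratio_def Gamma_real_pos)

lemma ln_stirling_ratio:
  assumes "s > 0"
  shows "ln (stirling_ratio s) = ln (Gamma (s + 1)) - s * (ln s - 1)"
  using assms Gamma_real_pos[of "s + 1"]
  by (simp add: stirling_ratio_def ln_div less_le)

lemma DERIV_ln_stirling_ratio:
  assumes "s > 0"
  shows "((\<lambda>s. ln (stirling_ratio s)) has_real_derivative Digamma (s + 1) - ln s) (at s)"
proof (rule has_field_derivative_transform_within_open[where S = "{0<..}"])
  show "((\<lambda>s. ln (Gamma (s + 1)) - s * (ln s - 1)) has_real_derivative Digamma (s + 1) - ln s) (at s)"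
    using assms Gamma_real_pos[of "s + 1"]
    by (auto intro!: derivative_eq_intros dest: nonpos_Ints_nonpos simp: less_le)
qed (use assms in \<open>auto simp: ln_stirling_ratio\<close>)

lemma stirling_ratio_mono:
  assumes "0 < q" "q \<le> p"
  shows "stirling_ratio q \<le> stirling_ratio p"
proof -
  have "ln (stirling_ratio q) \<le> ln (stirling_ratio p)"
    by (rule DERIV_nonneg_imp_nondecreasing[OF assms(2)])
       (use assms DERIV_ln_stirling_ratio Digamma_le_ln_le_Digamma(2) in \<open>smt (verit)\<close>)
  then show ?thesis using assms stirling_ratio_pos by simp
qed

text \<open>S(s)/s is nonincreasing: subtracting 1/s from the logarithmic derivative of S turns
  \<open>Digamma (s + 1)\<close> into \<open>Digamma s\<close>, so the other half of the Digamma
  estimate gives the sign.\<close>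

lemma stirling_ratio_le:
  assumes "0 < q" "q \<le> p"
  shows "stirling_ratio p \<le> p / q * stirling_ratio q"
proof -
  have "ln (stirling_ratio p) - ln p \<le> ln (stirling_ratio q) - ln q"
  proof (rule DERIV_nonpos_imp_nonincreasing[OF assms(2)])
    fix x assume "q \<le> x" "x \<le> p"
    then have "x > 0" using assms by simp
    moreover have "Digamma (x + 1) = Digamma x + 1 / x"
      using \<open>x > 0\<close> by (intro Digamma_plus1) simp
    ultimately show "\<exists>y. ((\<lambda>a. ln (stirling_ratio a) - ln a) has_real_derivative y) (at x) \<and> y \<le> 0"
      using Digamma_le_ln_le_Digamma(1)[of x]
        DERIV_diff[OF DERIV_ln_stirling_ratio DERIV_ln_divide, of x]
      by (intro exI[of _ "Digamma (x + 1) - ln x - 1 / x"]) simp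
  qed
  then have "ln (stirling_ratio p) \<le> ln (p / q * stirling_ratio q)"
    using assms stirling_ratio_pos[of q] by (simp add: ln_mult ln_div)
  then show ?thesis using assms stirling_ratio_pos by simp
qed

lemma stirling_ratio_1: "stirling_ratio 1 = exp 1"
  by (simp add: stirling_ratio_def Gamma_numeral)

text \<open>By monotonicity the worst case is q = 2, where S(2) = e^2/2 is about 3.69. The value
  18/5 is what \<open>exp_lower_numeric\<close> consumes.\<close>

lemma stirling_ratio_ge:
  assumes "q \<ge> 2"
  shows "stirling_ratio q \<ge> 18 / 5"
proof -
  have "27/10 \<le> (exp 1 :: real)" using abs_le_D2[OF e_approx_32] by simp
  then have e: "(27/10)\<^sup>2 \<le> (exp 1 :: real)\<^sup>2" by (intro power_mono) auto
  have "stirling_ratio 2 = (exp 1)\<^sup>2 / 2"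
    using Gamma_fact[of 2, where 'a = real]
    by (simp add: stirling_ratio_def power_divide)
  moreover have "stirling_ratio 2 \<le> stirling_ratio q"
    using assms by (intro stirling_ratio_mono) auto
  ultimately show ?thesis using e by (simp add: power2_eq_square)
qed

text \<open>The true w is about 0.278; the rough bound 1/3 is kept because the numerical estimate
  for the negative side uses 1/w \<ge> 3.\<close>

lemma C0_eq_exp:
  obtains w where "w > 0" "w \<le> 1/3" "w * exp w = exp (-1)" "C0 = exp w"
proof -
  let ?f = "\<lambda>x::real. x * exp x"
  have inj: "inj_on ?f {0<..}"
  proof (rule linorder_inj_onI)
    fix x y :: real assume "x < y" "x \<in> {0<..}"
    then have "?f x < ?f y" by (intro mult_strict_mono) auto
    then show "?f x \<noteq> ?f y" by simp
  qed auto
  have "\<exists>w\<ge>0. w \<le> 1/3 \<and> ?f w = exp (-1)"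
  proof (rule IVT')
    \<comment> \<open>At w = 1/3 the claim e^(-1) \<le> w e^w amounts to e^(4/3) \<ge> 3, and the
      quadratic Taylor polynomial 1 + 4/3 + 8/9 already exceeds 3.\<close>
    have "3 \<le> exp (4/3 :: real)"
      using exp_lower_Taylor_quadratic[of "4/3::real"] by (simp add: power2_eq_square)
    then have "exp (-(4/3)) \<le> (1/3 :: real)" by (simp add: exp_minus divide_simps)
    then have "exp (-(4/3)) * exp (1/3) \<le> 1/3 * exp (1/3::real)" by (rule mult_right_mono) simp
    then show "exp (-1) \<le> 1/3 * exp (1/3::real)" by (simp flip: exp_add)
  qed (auto intro!: continuous_intros)
  then obtain w where w: "w \<ge> 0" "w \<le> 1/3" "?f w = exp (-1)" by blast
  then have "w \<noteq> 0" by auto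
  then have "w > 0" using w by simp
  then have "lambert_W (exp (-1)) = w"
    unfolding lambert_W_def using inj w by (intro the_inv_into_f_eq) auto
  then have "C0 = exp w" by (simp add: C0_def exp_minus divide_inverse)
  then show ?thesis using that w \<open>w > 0\<close> by blast
qed

section \<open>Log-concave functions and moments on the half-line\<close>


text \<open>Stated multiplicatively, without logarithms, so that zeros of f need no separate
  treatment: \<open>0 powr t = 0\<close> makes the inequality trivial as soon as one of the two
  points lies outside the support.\<close>

definition log_concave :: "(real \<Rightarrow> real) \<Rightarrow> bool" where
  "log_concave f \<longleftrightarrow> (\<forall>x. 0 \<le> f x) \<and>
     (\<forall>x y t. 0 < t \<and> t < 1 \<longrightarrow> f x powr (1 - t) * f y powr t \<le> f ((1 - t) * x + t * y))"

lemma log_concave_nonneg: "log_concave f \<Longrightarrow> 0 \<le> f x"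
  by (simp add: log_concave_def)

lemma log_concave_reflect:
  assumes "log_concave f"
  shows "log_concave (\<lambda>x. f (- x))"
  unfolding log_concave_def
proof (intro conjI allI impI)
  fix x y t :: real assume "0 < t \<and> t < 1"
  then have "f (- x) powr (1 - t) * f (- y) powr t \<le> f ((1 - t) * (- x) + t * (- y))"
    using assms unfolding log_concave_def by blast
  then show "f (- x) powr (1 - t) * f (- y) powr t \<le> f (- ((1 - t) * x + t * y))"
    by (simp add: algebra_simps)
qed (simp add: assms log_concave_nonneg)

text \<open>An exponential satisfies the defining inequality of log-concavity with equality, so one
  strict and one weak inequality at the ends multiply to a strict one in between. The points may lie
  on either side of 0, which lets information pass between the two half-lines.\<close>

lemma log_concave_greater_exp_between:
  assumes f: "log_concave f" and K: "K > 0"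
    and x: "f x > K * exp (- \<mu> * x)" and z: "f z \<ge> K * exp (- \<mu> * z)"
    and y: "x < y \<and> y < z \<or> z < y \<and> y < x"
  shows "f y > K * exp (- \<mu> * y)"
proof -
  define t where "t = (y - x) / (z - x)"
  have t: "0 < t" "t < 1" using y by (auto simp: t_def divide_simps)
  have "t * (z - x) = y - x" using y by (auto simp: t_def)
  then have yt: "y = (1 - t) * x + t * z" by (simp add: algebra_simps)
  have "K * exp (- \<mu> * y) = K powr ((1 - t) + t) * exp ((1 - t) * (- \<mu> * x) + t * (- \<mu> * z))"
    using K by (simp add: yt algebra_simps)
  also have "\<dots> = (K * exp (- \<mu> * x)) powr (1 - t) * (K * exp (- \<mu> * z)) powr t"
    unfolding powr_add exp_add using K by (simp add: powr_mult exp_powr_real mult_ac)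
  also have "\<dots> < f x powr (1 - t) * f z powr t"
    using K x z t by (intro mult_less_le_imp_less powr_less_mono2 powr_mono2) auto
  also have "\<dots> \<le> f y"
    unfolding yt using f t unfolding log_concave_def by blast
  finally show ?thesis .
qed

text \<open>The chord inequality with its denominator cleared. Taking an end of the chord as the
  middle point b turns it into the lower bound for f outside the chord.\<close>

lemma convex_on_three_points:
  fixes f :: "real \<Rightarrow> real"
  assumes f: "convex_on S f" and S: "a \<in> S" "c \<in> S" and abc: "a \<le> b" "b \<le> c" "a < c"
  shows "f b * (c - a) \<le> f a * (c - b) + f c * (b - a)"
proof -
  define t where "t = (b - a) / (c - a)"
  have t: "0 \<le> t" "t \<le> 1" "t * (c - a) = b - a" using abc by (auto simp: t_def divide_simps)
  then have "b = (1 - t) *\<^sub>R a + t *\<^sub>R c" by (simp add: algebra_simps)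
  then have "f b \<le> (1 - t) * f a + t * f c"
    using convex_onD[OF f t(1,2) S] by simp
  then have "f b * (c - a) \<le> ((1 - t) * f a + t * f c) * (c - a)"
    using abc by (intro mult_right_mono) auto
  also have "\<dots> = f a * ((c - a) - t * (c - a)) + f c * (t * (c - a))"
    by (simp add: algebra_simps)
  finally show ?thesis unfolding t(3) by simp
qed

text \<open>The function $A + B x^q$ is the chord of $y \mapsto y^{p/q}$ in the variable $y = x^q$.\<close>

lemma powr_chord:
  fixes p q x1 x2 :: real
  assumes pq: "0 < q" "q < p" and x12: "0 \<le> x1" "x1 < x2"
  obtains A B where
    "\<And>x. x > 0 \<Longrightarrow> x1 \<le> x \<Longrightarrow> x \<le> x2 \<Longrightarrow> x powr p \<le> A + B * x powr q"
    "\<And>x. x > 0 \<Longrightarrow> x \<le> x1 \<or> x2 \<le> x \<Longrightarrow> A + B * x powr q \<le> x powr p"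
proof (cases "x1 = 0")
  \<comment> \<open>The left end y = 0 is not in the open set on which convexity is available. The
    chord through the origin is explicit instead, with slope \<open>x2 powr (p - q)\<close>, and the
    comparison is monotonicity of \<open>x powr (p - q)\<close>.\<close>
  case True
  have e: "x powr p = x powr (p - q) * x powr q" for x :: real
    by (simp flip: powr_add)
  show ?thesis
  proof (rule that[of 0 "x2 powr (p - q)"])
    fix x :: real assume "x > 0" "x \<le> x2"
    then show "x powr p \<le> 0 + x2 powr (p - q) * x powr q"
      using pq unfolding e[of x] by (auto intro!: mult_right_mono powr_mono2)
  next
    fix x :: real assume "x > 0" "x \<le> x1 \<or> x2 \<le> x"
    then show "0 + x2 powr (p - q) * x powr q \<le> x powr p"
      using pq x12 True unfolding e[of x] by (auto intro!: mult_right_mono powr_mono2)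
  qed
next
  case False
  define y1 y2 where "y1 = x1 powr q" and "y2 = x2 powr q"
  have y: "0 < y1" "y1 < y2"
    using x12 pq False by (auto simp: y1_def y2_def intro: powr_less_mono2)
  let ?h = "\<lambda>y. y powr (p / q)"
  have cvx: "convex_on {0<..} ?h" using pq by (intro powr_convex) auto
  define B where "B = (?h y2 - ?h y1) / (y2 - y1)"
  define A where "A = ?h y1 - B * y1"
  have B: "B * (y2 - y1) = ?h y2 - ?h y1" using y by (simp add: B_def)
  have L: "(A + B * v) * (y2 - y1) = ?h y1 * (y2 - v) + ?h y2 * (v - y1)" for v
  proof -
    have "(A + B * v) * (y2 - y1) = ?h y1 * (y2 - y1) + (B * (y2 - y1)) * (v - y1)"
      by (simp add: A_def algebra_simps)
    then show ?thesis unfolding B by (simp add: algebra_simps)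
  qed
  have xp: "x powr p = ?h (x powr q)" if "x > 0" for x
    using pq by (simp add: powr_powr)
  show ?thesis
  proof (rule that[of A B])
    fix x :: real assume x: "x > 0" "x1 \<le> x" "x \<le> x2"
    then have "y1 \<le> x powr q" "x powr q \<le> y2"
      using x12 pq by (auto simp: y1_def y2_def intro: powr_mono2)
    then have "?h (x powr q) * (y2 - y1) \<le> (A + B * x powr q) * (y2 - y1)"
      unfolding L using y by (intro convex_on_three_points[OF cvx]) auto
    then show "x powr p \<le> A + B * x powr q" using y xp x by simp
  next
    fix x :: real assume x: "x > 0" "x \<le> x1 \<or> x2 \<le> x"
    then have "x powr q \<le> y1 \<or> y2 \<le> x powr q"
      using x12 pq by (auto simp: y1_def y2_def intro: powr_mono2)
    then have "(A + B * x powr q) * (y2 - y1) \<le> ?h (x powr q) * (y2 - y1)"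
    proof
      assume "x powr q \<le> y1"
      then show ?thesis
        unfolding L using y x convex_on_three_points[OF cvx, of "x powr q" y2 y1]
        by (simp add: algebra_simps)
    next
      assume "y2 \<le> x powr q"
      then show ?thesis
        unfolding L using y x convex_on_three_points[OF cvx, of y1 "x powr q" y2]
        by (simp add: algebra_simps)
    qed
    then show "A + B * x powr q \<le> x powr p" using y xp x by simp
  qed
qed

definition half_moment_fun :: "(real \<Rightarrow> real) \<Rightarrow> real \<Rightarrow> real \<Rightarrow> real" where
  "half_moment_fun f s x = indicator {0<..} x * (x powr s * f x)"

text \<open>For a density this is E[X_+^s], and P(X > 0) for s = 0; the negative side is reached
  through \<open>\<lambda>x. f (- x)\<close>. The integral defaults to 0 when it does not exist,
  hence the separate integrability hypotheses below.\<close>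

definition half_moment :: "(real \<Rightarrow> real) \<Rightarrow> real \<Rightarrow> real" where
  "half_moment f s = integral\<^sup>L lborel (half_moment_fun f s)"

lemma measurable_half_moment_fun[measurable]:
  "f \<in> borel_measurable borel \<Longrightarrow> half_moment_fun f s \<in> borel_measurable borel"
  unfolding half_moment_fun_def by measurable

lemma half_moment_fun_exp:
  assumes "s \<ge> 0" "\<mu> > 0"
  shows "has_bochner_integral lborel (half_moment_fun (\<lambda>x. K * exp (- \<mu> * x)) s)
           (K * Gamma (s + 1) / \<mu> powr (s + 1))"
proof -
  let ?h = "\<lambda>x::real. indicator {0<..} x * (x powr s * exp (- x))"
  have "(\<integral>\<^sup>+x. ennreal (?h x) \<partial>lborel)
      = (\<integral>\<^sup>+x. ennreal (indicator {0..} x * x powr (s + 1 - 1) / exp x) \<partial>lborel)"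
    by (rule nn_integral_cong_AE, rule AE_mp[OF AE_lborel_singleton[of 0]])
       (auto simp: indicator_def exp_minus divide_inverse)
  also have "\<dots> = ennreal (Gamma (s + 1))"
    using assms by (subst Gamma_conv_nn_integral_real) auto
  finally have "has_bochner_integral lborel ?h (Gamma (s + 1))"
    using assms Gamma_real_pos[of "s + 1"]
    by (intro has_bochner_integral_nn_integral) (auto simp: indicator_def)
  then have "has_bochner_integral lborel (\<lambda>x. ?h (0 + \<mu> * x)) (Gamma (s + 1) /\<^sub>R \<bar>\<mu>\<bar>)"
    using assms by (subst (asm) lborel_has_bochner_integral_real_affine_iff[of \<mu> _ _ 0]) auto
  then have "has_bochner_integral lborel (\<lambda>x. (K / \<mu> powr s) * ?h (0 + \<mu> * x))
      ((K / \<mu> powr s) * (Gamma (s + 1) /\<^sub>R \<bar>\<mu>\<bar>))"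
    by (intro has_bochner_integral_mult_right)
  moreover have "(K / \<mu> powr s) * ?h (0 + \<mu> * x) = half_moment_fun (\<lambda>x. K * exp (- \<mu> * x)) s x" for x
    using assms by (auto simp: half_moment_fun_def indicator_def powr_mult zero_less_mult_iff)
  moreover have "(K / \<mu> powr s) * (Gamma (s + 1) /\<^sub>R \<bar>\<mu>\<bar>) = K * Gamma (s + 1) / \<mu> powr (s + 1)"
    using assms by (simp add: powr_add divide_inverse mult_ac)
  ultimately show ?thesis by simp
qed

lemma AE_lborel_open_interval_ex:
  fixes l u :: real
  assumes "l < u" and AE: "AE x in lborel. l < x \<longrightarrow> x < u \<longrightarrow> P x"
  shows "\<exists>x. l < x \<and> x < u \<and> P x"
proof (rule ccontr)
  assume "\<not> ?thesis"
  then have "AE x in lborel. x \<notin> {l<..<u}" using AE by (auto elim: eventually_mono)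
  then have "emeasure lborel {l<..<u} = 0"
    by (subst (asm) AE_iff_measurable[where N = "{l<..<u}"]) auto
  then show False using \<open>l < u\<close> by simp
qed

text \<open>The factor \<sigma> treats both orders of the signs at once, and c = 0 covers a function
  of constant sign.\<close>

lemma single_crossing_imp_AE_zero:
  assumes d: "has_bochner_integral lborel (half_moment_fun d 0) 0"
      "has_bochner_integral lborel (half_moment_fun d q) 0"
    and q: "q > 0" and c: "c \<ge> 0"
    and sign: "\<And>x. x > 0 \<Longrightarrow> \<sigma> * (x - c) * d x \<ge> 0" and \<sigma>: "\<sigma> \<noteq> 0"
  shows "AE x in lborel. x > 0 \<longrightarrow> d x = 0"
proof -
  \<comment> \<open>integrate $d$ against $x^q - c^q$, which changes sign where $d$ does\<close>
  let ?\<phi> = "\<lambda>x. \<sigma> * (half_moment_fun d q x - c powr q * half_moment_fun d 0 x)"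
  have I: "has_bochner_integral lborel ?\<phi> (\<sigma> * (0 - c powr q * 0))"
    by (intro has_bochner_integral_mult_right has_bochner_integral_diff d)
  have eq: "?\<phi> x = (x powr q - c powr q) * (\<sigma> * d x)" if "x > 0" for x
    using that by (simp add: half_moment_fun_def algebra_simps)
  have "?\<phi> x \<ge> 0" for x
  proof (cases "x > 0")
    case True
    consider "x > c" | "x = c" | "x < c" by linarith
    then show ?thesis
    proof cases
      case 1
      then have "\<sigma> * d x \<ge> 0" using sign[OF True]
        by (simp add: mult.assoc mult.left_commute[of \<sigma>] zero_le_mult_iff)
      then show ?thesis unfolding eq[OF True] using 1 q c by (simp add: powr_mono2)
    next
      case 3
      then have "\<sigma> * d x \<le> 0" using sign[OF True]
        by (simp add: mult.assoc mult.left_commute[of \<sigma>] zero_le_mult_iff)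
      then show ?thesis unfolding eq[OF True] using 3 q True
        by (intro mult_nonpos_nonpos) (auto simp: powr_mono2)
    next
      case 2
      then show ?thesis unfolding eq[OF True] by simp
    qed
  qed (simp add: half_moment_fun_def)
  then have "AE x in lborel. ?\<phi> x = 0"
    using I by (subst integral_nonneg_eq_0_iff_AE[symmetric])
      (auto simp: has_bochner_integral_iff)
  then show ?thesis using AE_lborel_singleton[of c]
  proof eventually_elim
    case (elim x)
    show ?case
    proof
      assume x: "x > 0"
      then have "x powr q \<noteq> c powr q"
        using elim(2) q c powr_less_mono2[of q x c] powr_less_mono2[of q c x]
        by (cases x c rule: linorder_cases) auto
      then show "d x = 0" using elim(1) \<sigma> unfolding eq[OF x] by simp
    qed
  qed
qed

section \<open>Comparison with an exponential density\<close>


lemma half_moment_fun_diff: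
  "half_moment_fun (\<lambda>x. f x - g x) s x = half_moment_fun f s x - half_moment_fun g s x"
  by (simp add: half_moment_fun_def algebra_simps)

text \<open>The two moment values are those of K e^(-\<mu>x), so f and this exponential agree on the
  positive half-line in mass and in q-th moment. The mass K/\<mu> is arbitrary because f is to be a
  density on the whole line.\<close>

locale exp_comparison =
  fixes f :: "real \<Rightarrow> real" and K \<mu> q :: real
  assumes log_concave: "log_concave f"
    and measurable_f[measurable]: "f \<in> borel_measurable borel"
    and pos: "K > 0" "\<mu> > 0" "q > 0"
    and moment_0: "has_bochner_integral lborel (half_moment_fun f 0) (K / \<mu>)"
    and moment_q: "has_bochner_integral lborel (half_moment_fun f q) (K * Gamma (q + 1) / \<mu> powr (q + 1))"
begin

abbreviation g :: "real \<Rightarrow> real" where "g \<equiv> \<lambda>x. K * exp (- \<mu> * x)"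

lemma g_moment:
  "s \<ge> 0 \<Longrightarrow> has_bochner_integral lborel (half_moment_fun g s) (K * Gamma (s + 1) / \<mu> powr (s + 1))"
  using pos by (intro half_moment_fun_exp) auto

lemma greater_between:
  assumes "f x > g x" "f z \<ge> g z" "x < y \<and> y < z \<or> z < y \<and> y < x"
  shows "f y > g y"
  using log_concave_greater_exp_between[OF log_concave pos(1) assms] .

text \<open>Matching two moments forces f - g to change sign at least twice, unless it vanishes
  almost everywhere; the interval (l, u) has positive measure and rules out the exception.\<close>

lemma no_single_crossing:
  assumes "c \<ge> 0" "\<sigma> \<noteq> 0" and sign: "\<And>x. x > 0 \<Longrightarrow> \<sigma> * (x - c) * (f x - g x) \<ge> 0"
    and ne: "0 \<le> l" "l < u" "\<And>x. l < x \<Longrightarrow> x < u \<Longrightarrow> f x \<noteq> g x"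
  shows False
proof -
  have "has_bochner_integral lborel (half_moment_fun (\<lambda>x. f x - g x) 0) (K / \<mu> - K / \<mu>)"
    unfolding half_moment_fun_diff
    using moment_0 g_moment[of 0] pos by (intro has_bochner_integral_diff) auto
  moreover have "has_bochner_integral lborel (half_moment_fun (\<lambda>x. f x - g x) q)
      (K * Gamma (q + 1) / \<mu> powr (q + 1) - K * Gamma (q + 1) / \<mu> powr (q + 1))"
    unfolding half_moment_fun_diff
    using moment_q g_moment[of q] pos by (intro has_bochner_integral_diff) auto
  ultimately have "AE x in lborel. x > 0 \<longrightarrow> f x - g x = 0"
    using assms(1,2) sign pos
    by (intro single_crossing_imp_AE_zero[of _ q c \<sigma>]) auto
  then have "AE x in lborel. l < x \<longrightarrow> x < u \<longrightarrow> f x - g x = 0"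
    using ne(1) by (auto elim: eventually_mono)
  from AE_lborel_open_interval_ex[OF ne(2) this] ne(3) show False by auto
qed

text \<open>A point y \<le> 0 with f y > g y would make the set of x > 0 with f x \<ge> g x an
  initial segment of the half-line, with strict inequality below each of its points. Then f - g
  changes sign at most once, from + to -, contradicting the matched moments. The cases are: segment
  empty, everything, or ending at c.\<close>

lemma le_exp_left:
  assumes "y \<le> 0"
  shows "f y \<le> g y"
proof (rule ccontr)
  assume "\<not> f y \<le> g y"
  then have y: "f y > g y" by simp
  define Z where "Z = {x. x > 0 \<and> f x \<ge> g x}"
  have below: "f x > g x" if "z \<in> Z" "0 < x" "x < z" for x z
    using greater_between[OF y, of z x] that assms by (auto simp: Z_def)
  consider "Z = {}" | "Z \<noteq> {}" "\<not> bdd_above Z" | "Z \<noteq> {}" "bdd_above Z" by argo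
  then show False
  proof cases
    case 1
    then have "f x < g x" if "x > 0" for x using that by (auto simp: Z_def not_le)
    then show False
      using no_single_crossing[of 0 "-1" 0 1] by (force simp: mult_le_0_iff)
  next
    case 2
    have "f x > g x" if "x > 0" for x
    proof -
      obtain z where "z \<in> Z" "x < z" using 2 by (auto simp: bdd_above_def not_le)
      then show ?thesis using below that by blast
    qed
    then show False
      using no_single_crossing[of 0 1 0 1] by (force simp: zero_le_mult_iff)
  next
    case 3
    define c where "c = Sup Z"
    have c: "c > 0"
      using 3 cSup_upper[of _ Z] by (auto simp: c_def Z_def intro: less_le_trans)
    have lt: "f x > g x" if "0 < x" "x < c" for x
      using 3 that below less_cSup_iff[of Z x] by (auto simp: c_def)
    have gt: "f x < g x" if "c < x" for x
    proof -
      have "x \<notin> Z" using 3 that cSup_upper[of x Z] by (auto simp: c_def)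
      then show ?thesis using that c by (auto simp: Z_def)
    qed
    have "- 1 * (x - c) * (f x - g x) \<ge> 0" if "x > 0" for x
      using lt[of x] gt[of x] that by (cases x c rule: linorder_cases) (auto simp: zero_le_mult_iff)
    then show False
      using c lt by (intro no_single_crossing[of c "-1" 0 c]) force+
  qed
qed

text \<open>The chord in x^q is made to cross x^p exactly where f - g changes sign, so that (x^p - A
  - B x^q)(f - g) \<le> 0. The g-term stands on the right because integrability of x^p f is not yet
  known; it is deduced from this bound.\<close>

lemma ex_dominating_chord:
  assumes "q < p"
  shows "\<exists>A B. AE x in lborel. x > 0 \<longrightarrow>
           x powr p * f x \<le> x powr p * g x + (A + B * x powr q) * (f x - g x)"
proof -
  define D where "D = {x. x > 0 \<and> f x > g x}"
  have D_bdd: "bdd_below D" by (auto simp: D_def bdd_below_def intro!: exI[of _ 0])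
  have between: "x \<in> D" if "y \<in> D" "z \<in> D" "y < x" "x < z" for x y z
    using greater_between[of y z x] that by (auto simp: D_def)
  consider "D = {}" | "D \<noteq> {}" "\<not> bdd_above D" | "D \<noteq> {}" "bdd_above D" by argo
  then show ?thesis
  proof cases
    case 1
    then have "f x \<le> g x" if "x > 0" for x using that by (auto simp: D_def not_less[symmetric])
    then have "AE x in lborel. x > 0 \<longrightarrow>
        x powr p * f x \<le> x powr p * g x + (0 + 0 * x powr q) * (f x - g x)"
      by (intro AE_I2) (simp add: mult_left_mono)
    then show ?thesis by blast
  next
    \<comment> \<open>If f exceeded g arbitrarily far out, the set D would be a ray up to its end
      point and f - g would change sign only once, from - to +.\<close>
    case 2
    define c where "c = Inf D"
    have c: "c \<ge> 0" using 2 by (auto simp: c_def D_def intro!: cInf_greatest)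
    have gt: "f x > g x" if x: "c < x" for x
    proof -
      obtain z where "z \<in> D" "x < z" using 2 by (auto simp: bdd_above_def not_le)
      moreover obtain y where "y \<in> D" "y < x" using 2 x cInf_lessD[of D x] by (auto simp: c_def)
      ultimately have "x \<in> D" using between by blast
      then show ?thesis by (simp add: D_def)
    qed
    have lt: "f x \<le> g x" if "0 < x" "x < c" for x
    proof -
      have "x \<notin> D" using that cInf_lower[OF _ D_bdd, of x] by (auto simp: c_def)
      then show ?thesis using that by (auto simp: D_def)
    qed
    have "1 * (x - c) * (f x - g x) \<ge> 0" if "x > 0" for x
      using lt[of x] gt[of x] that by (cases x c rule: linorder_cases) (auto simp: zero_le_mult_iff)
    then have False
      using c gt by (intro no_single_crossing[of c 1 c "c + 1"]) force+
    then show ?thesis ..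
  next
    case 3
    define x1 x2 where "x1 = Inf D" and "x2 = Sup D"
    have x12: "0 \<le> x1" "x1 \<le> x2"
      using 3 D_bdd by (auto simp: x1_def x2_def D_def intro!: cInf_greatest cInf_le_cSup)
    have outside: "f x \<le> g x" if "x > 0" "x < x1 \<or> x2 < x" for x
    proof -
      have "x \<notin> D"
        using that 3 cInf_lower[OF _ D_bdd, of x] cSup_upper[of x D] by (auto simp: x1_def x2_def)
      then show ?thesis using that by (auto simp: D_def)
    qed
    have inside: "f x > g x" if x: "x1 < x" "x < x2" for x
    proof -
      obtain y where "y \<in> D" "y < x" using x 3 cInf_lessD[of D x] by (auto simp: x1_def)
      moreover obtain z where "z \<in> D" "x < z"
        using x 3 less_cSup_iff[of D x] by (auto simp: x2_def)
      ultimately have "x \<in> D" using between by blast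
      then show ?thesis by (simp add: D_def)
    qed
    show ?thesis
    proof (cases "x1 = x2")
      \<comment> \<open>D is a single point here, hence a null set, and A = B = 0 works; this is why
        the bound is claimed only almost everywhere.\<close>
      case True
      have "AE x in lborel. x > 0 \<longrightarrow> x powr p * f x \<le> x powr p * g x + (0 + 0 * x powr q) * (f x - g x)"
        using AE_lborel_singleton[of x1]
      proof eventually_elim
        case (elim x)
        then have "x > 0 \<Longrightarrow> f x \<le> g x" using outside[of x] True by linarith
        then show ?case by (simp add: mult_left_mono)
      qed
      then show ?thesis by blast
    next
      case False
      then obtain A B where
        AB: "\<And>x. x > 0 \<Longrightarrow> x1 \<le> x \<Longrightarrow> x \<le> x2 \<Longrightarrow> x powr p \<le> A + B * x powr q"
            "\<And>x. x > 0 \<Longrightarrow> x \<le> x1 \<or> x2 \<le> x \<Longrightarrow> A + B * x powr q \<le> x powr p"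
        using powr_chord[OF pos(3) assms x12(1), of x2] x12(2) by (metis le_less)
      have "x powr p * f x \<le> x powr p * g x + (A + B * x powr q) * (f x - g x)" if x: "x > 0" for x
      proof -
        have "(x powr p - (A + B * x powr q)) * (f x - g x) \<le> 0"
        proof -
          consider "x1 < x" "x < x2" | "x < x1 \<or> x2 < x" | "x = x1 \<or> x = x2" by linarith
          then show ?thesis
          proof cases
            case 1
            then show ?thesis using AB(1)[OF x] inside[of x] by (intro mult_nonpos_nonneg) auto
          next
            case 2
            then have "x \<le> x1 \<or> x2 \<le> x" by auto
            then show ?thesis using AB(2)[OF x] outside[OF x 2] by (intro mult_nonneg_nonpos) auto
          next
            \<comment> \<open>At the ends of D the sign of f - g is unknown, but both chord
              inequalities apply there, so the other factor vanishes.\<close>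
            case 3
            then have "x powr p = A + B * x powr q" using AB[OF x] x12 by (auto intro!: antisym)
            then show ?thesis by simp
          qed
        qed
        then show ?thesis by (simp add: algebra_simps)
      qed
      then have "AE x in lborel. x > 0 \<longrightarrow>
          x powr p * f x \<le> x powr p * g x + (A + B * x powr q) * (f x - g x)"
        by (intro AE_I2) blast
      then show ?thesis by blast
    qed
  qed
qed

lemma moment_le:
  assumes "q < p"
  shows "integrable lborel (half_moment_fun f p)"
    and "half_moment f p \<le> K * Gamma (p + 1) / \<mu> powr (p + 1)"
proof -
  obtain A B where AB: "AE x in lborel. x > 0 \<longrightarrow>
      x powr p * f x \<le> x powr p * g x + (A + B * x powr q) * (f x - g x)"
    using ex_dominating_chord[OF assms] by blast
  \<comment> \<open>The terms with A and B integrate to 0 because the moments of orders 0 and q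
    match, so ?R is an integrable majorant whose integral is the p-th moment of g.\<close>
  let ?R = "\<lambda>x. half_moment_fun g p x
      + (A * (half_moment_fun f 0 x - half_moment_fun g 0 x)
       + B * (half_moment_fun f q x - half_moment_fun g q x))"
  have "has_bochner_integral lborel ?R
      (K * Gamma (p + 1) / \<mu> powr (p + 1) + (A * (K / \<mu> - K / \<mu>)
        + B * (K * Gamma (q + 1) / \<mu> powr (q + 1) - K * Gamma (q + 1) / \<mu> powr (q + 1))))"
    using pos assms g_moment[of 0] moment_0 moment_q
    by (intro has_bochner_integral_add has_bochner_integral_mult_right has_bochner_integral_diff g_moment)
       auto
  then have R: "has_bochner_integral lborel ?R (K * Gamma (p + 1) / \<mu> powr (p + 1))" by simp
  have le: "AE x in lborel. half_moment_fun f p x \<le> ?R x"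
    using AB by eventually_elim (auto simp: half_moment_fun_def indicator_def algebra_simps)
  have nonneg: "half_moment_fun f p x \<ge> 0" for x
    using log_concave_nonneg[OF log_concave] by (simp add: half_moment_fun_def)
  show I: "integrable lborel (half_moment_fun f p)"
  proof (rule Bochner_Integration.integrable_bound)
    show "integrable lborel ?R" using R by (simp add: has_bochner_integral_iff)
    show "AE x in lborel. norm (half_moment_fun f p x) \<le> norm (?R x)"
      using le nonneg by (auto elim!: eventually_mono intro: order_trans[OF _ abs_ge_self])
  qed measurable
  have "half_moment f p \<le> integral\<^sup>L lborel ?R"
    unfolding half_moment_def using I R le by (intro integral_mono_AE) (auto simp: has_bochner_integral_iff)
  then show "half_moment f p \<le> K * Gamma (p + 1) / \<mu> powr (p + 1)"
    using R by (simp add: has_bochner_integral_iff)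
qed

end

lemma half_moment_pos:
  assumes f: "\<And>x. f x \<ge> 0" and I: "integrable lborel (half_moment_fun f r)" and pos: "half_moment f s > 0"
  shows "half_moment f r > 0"
proof (rule ccontr)
  have nonneg: "half_moment_fun f r x \<ge> 0" for x using f by (simp add: half_moment_fun_def)
  then have "half_moment f r \<ge> 0" by (simp add: half_moment_def)
  moreover assume "\<not> half_moment f r > 0"
  ultimately have "half_moment f r = 0" by simp
  then have "AE x in lborel. half_moment_fun f r x = 0"
    using I nonneg by (subst integral_nonneg_eq_0_iff_AE[symmetric]) (auto simp: half_moment_def)
  then have "AE x in lborel. half_moment_fun f s x = 0"
    by eventually_elim (auto simp: half_moment_fun_def indicator_def split: if_splits)
  then have "half_moment f s = 0"
    unfolding half_moment_def by (rule integral_eq_zero_AE)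
  with pos show False by simp
qed

lemma log_concave_half_line:
  assumes f: "log_concave f" "f \<in> borel_measurable borel"
    and I: "integrable lborel (half_moment_fun f 0)" "integrable lborel (half_moment_fun f q)"
    and m: "half_moment f 0 > 0" and q: "q > 0"
  obtains \<mu> where "\<mu> > 0"
    "half_moment f q = half_moment f 0 * Gamma (q + 1) / \<mu> powr q"
    "\<And>y. y \<le> 0 \<Longrightarrow> f y \<le> half_moment f 0 * \<mu> * exp (- \<mu> * y)"
    "\<And>p. q < p \<Longrightarrow> integrable lborel (half_moment_fun f p)"
    "\<And>p. q < p \<Longrightarrow> half_moment f p \<le> half_moment f 0 * Gamma (p + 1) / \<mu> powr p"
proof -
  define m where "m = half_moment f 0"
  define \<alpha> where "\<alpha> = half_moment f q"
  have m0: "m > 0" using m by (simp add: m_def)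
  have \<alpha>0: "\<alpha> > 0" unfolding \<alpha>_def using half_moment_pos[OF log_concave_nonneg[OF f(1)] I(2) m] .
  have G: "Gamma (q + 1) > 0" using q by (intro Gamma_real_pos) auto
  \<comment> \<open>The rate is solved from the q-th moment equation. The scale of the exponential
    is then m \<mu>, which fixes the mass at m.\<close>
  define \<mu> where "\<mu> = (m * Gamma (q + 1) / \<alpha>) powr (1 / q)"
  have \<mu>: "\<mu> > 0" using m0 \<alpha>0 G by (simp add: \<mu>_def)
  have "\<mu> powr q = m * Gamma (q + 1) / \<alpha>" using q m0 \<alpha>0 G by (simp add: \<mu>_def powr_powr)
  then have \<alpha>: "\<alpha> = m * Gamma (q + 1) / \<mu> powr q" using \<mu> \<alpha>0 by (simp add: field_simps)
  have e: "m * \<mu> * c / \<mu> powr (s + 1) = m * c / \<mu> powr s" for c s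
    using \<mu> by (simp add: powr_add)
  have "has_bochner_integral lborel (half_moment_fun f 0) (m * \<mu> / \<mu>)"
    using I(1) \<mu> by (simp add: has_bochner_integral_iff m_def half_moment_def)
  moreover have "has_bochner_integral lborel (half_moment_fun f q)
      (m * \<mu> * Gamma (q + 1) / \<mu> powr (q + 1))"
    using I(2) \<alpha> unfolding e by (simp add: has_bochner_integral_iff \<alpha>_def half_moment_def)
  ultimately interpret exp_comparison f "m * \<mu>" \<mu> q
    using f m0 \<mu> q by unfold_locales auto
  show ?thesis
  proof (rule that[OF \<mu>])
    show "half_moment f q = half_moment f 0 * Gamma (q + 1) / \<mu> powr q"
      using \<alpha> by (simp add: m_def \<alpha>_def)
    show "f y \<le> half_moment f 0 * \<mu> * exp (- \<mu> * y)" if "y \<le> 0" for y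
      using le_exp_left[OF that] by (simp add: m_def)
    show "integrable lborel (half_moment_fun f p)" if "q < p" for p
      using moment_le(1)[OF that] .
    show "half_moment f p \<le> half_moment f 0 * Gamma (p + 1) / \<mu> powr p" if "q < p" for p
      using moment_le(2)[OF that] unfolding e by (simp add: m_def)
  qed
qed


section \<open>Lower bound for the moment of the negative side\<close>

lemma powr_ge_tangent:
  fixes z q :: real
  assumes "z \<ge> 1" "q \<ge> 1"
  shows "1 + q * (z - 1) \<le> z powr q"
proof -
  have "1 powr q - q * 1 \<le> z powr q - q * z"
  proof (rule DERIV_nonneg_imp_nondecreasing[OF assms(1)])
    fix x :: real assume x: "1 \<le> x"
    have "((\<lambda>x. x powr q - q * x) has_real_derivative q * x powr (q - 1) - q) (at x)"
      using x by (auto intro!: derivative_eq_intros)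
    moreover have "q * 1 \<le> q * x powr (q - 1)"
      using x assms by (intro mult_left_mono ge_one_powr_ge_zero) auto
    ultimately show "\<exists>y. ((\<lambda>x. x powr q - q * x) has_real_derivative y) (at x) \<and> 0 \<le> y"
      by (intro exI[of _ "q * x powr (q - 1) - q"]) auto
  qed
  then show ?thesis by (simp add: algebra_simps)
qed

text \<open>The right-hand side bounds below the $q$-th moment of the density $m \mu e^{\mu y}$ on
  $[0, a/\mu]$, which is the one of the given mass under the given bound closest to $0$; the power
  $y^q$ is replaced by its tangent at $b/\mu$, which makes the integral elementary.\<close>

lemma moment_ge_truncated_exp:
  fixes k :: "real \<Rightarrow> real"
  assumes k: "\<And>y. k y \<ge> 0" "\<And>y. y > 0 \<Longrightarrow> k y \<le> m * \<mu> * exp (\<mu> * y)"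
    and k0: "has_bochner_integral lborel (half_moment_fun k 0) (m * (exp a - 1))"
    and kq: "integrable lborel (half_moment_fun k q)"
    and pos: "m > 0" "\<mu> > 0" "0 < b" "b \<le> a" "1 \<le> q"
  shows "m * (b / \<mu>) powr q * (exp a * (1 + q * (a - b - 1) / b) - exp b * (1 - q / b))
           \<le> half_moment k q"
proof -
  define c T cq where "c = b / \<mu>" and "T = a / \<mu>" and "cq = c powr q"
  \<comment> \<open>The tangent of y^q at c, written in \<mu> y: since \<mu> c = b, it is c^q (1 + q
    (y/c - 1)). Bernoulli's inequality places it below y^q for y \<ge> c.\<close>
  define \<psi> where "\<psi> = (\<lambda>y. cq * (1 + q * (\<mu> * y - b) / b))"
  define G where "G = (\<lambda>y. m * \<mu> * exp (\<mu> * y))"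
  have c: "0 < c" "c \<le> T" "\<mu> * c = b" "\<mu> * T = a" and cq: "cq > 0"
    using pos by (auto simp: c_def T_def cq_def divide_right_mono)
  have \<psi>T: "\<psi> T \<ge> 0" using pos cq unfolding \<psi>_def c by simp
  have \<psi>_mono: "\<psi> x \<le> \<psi> y" if "x \<le> y" for x y
    unfolding \<psi>_def using that pos cq
    by (intro mult_left_mono add_left_mono divide_right_mono) auto
  have \<psi>_le: "\<psi> y \<le> y powr q" if "c \<le> y" for y
  proof -
    have "1 + q * (y / c - 1) \<le> (y / c) powr q"
      using that c pos by (intro powr_ge_tangent) auto
    also have "q * (y / c - 1) = q * (\<mu> * y - b) / b"
      using pos by (simp add: c_def field_simps)
    also have "(y / c) powr q = y powr q / cq" using that c by (simp add: powr_divide cq_def)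
    finally show ?thesis using cq by (simp add: \<psi>_def field_simps)
  qed
  \<comment> \<open>A bathtub argument. Let h be 0 on (0, c) and \<psi> from c on, so h \<le> y^q.
    Then (h(y) - \<psi>(T)) (k - G 1_[0,T]) \<ge> 0: up to T both factors are nonpositive, beyond T
    both are nonnegative. Expanding gives ?R \<le> y^q k, and the two terms with \<psi>(T) cancel
    after integration because k and G 1_[0,T] have equal mass.\<close>
  let ?R = "\<lambda>y. \<psi> T * half_moment_fun k 0 y - \<psi> T * (G y * indicator {0..T} y)
              + \<psi> y * G y * indicator {c..T} y"
  have 1: "has_bochner_integral lborel (\<lambda>y. G y * indicator {0..T} y) (m * exp (\<mu> * T) - m * exp (\<mu> * 0))"
    using c by (intro has_bochner_integral_FTC_Icc_real)
      (auto simp: G_def intro!: derivative_eq_intros continuous_intros)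
  have 2: "has_bochner_integral lborel (\<lambda>y. \<psi> y * G y * indicator {c..T} y)
      (m * cq * exp (\<mu> * T) * (1 + q * (\<mu> * T - b - 1) / b) - m * cq * exp (\<mu> * c) * (1 + q * (\<mu> * c - b - 1) / b))"
  proof (rule has_bochner_integral_FTC_Icc_real)
    fix y
    have "((\<lambda>y. m * cq * exp (\<mu> * y) * (1 + q * (\<mu> * y - b - 1) / b)) has_real_derivative
      m * cq * (\<mu> * exp (\<mu> * y)) * (1 + q * (\<mu> * y - b - 1) / b) + m * cq * exp (\<mu> * y) * (q * \<mu> / b)) (at y)"
      using pos by (auto intro!: derivative_eq_intros)
    also have "m * cq * (\<mu> * exp (\<mu> * y)) * (1 + q * (\<mu> * y - b - 1) / b) + m * cq * exp (\<mu> * y) * (q * \<mu> / b)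
        = \<psi> y * G y"
      using pos by (simp add: \<psi>_def G_def field_simps)
    finally show "((\<lambda>y. m * cq * exp (\<mu> * y) * (1 + q * (\<mu> * y - b - 1) / b)) has_real_derivative \<psi> y * G y) (at y)" .
    show "isCont (\<lambda>y. \<psi> y * G y) y" unfolding \<psi>_def G_def using pos by (auto intro!: continuous_intros)
  qed (use c in auto)
  have R: "has_bochner_integral lborel ?R (\<psi> T * (m * (exp a - 1)) - \<psi> T * (m * exp (\<mu> * T) - m * exp (\<mu> * 0))
     + (m * cq * exp (\<mu> * T) * (1 + q * (\<mu> * T - b - 1) / b) - m * cq * exp (\<mu> * c) * (1 + q * (\<mu> * c - b - 1) / b)))"
    by (intro has_bochner_integral_add has_bochner_integral_diff has_bochner_integral_mult_right k0 1 2)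
  have "?R y \<le> half_moment_fun k q y" if "y \<noteq> 0" for y
  proof (cases "y > 0")
    case True
    have kG: "k y \<le> G y" using k(2)[OF True] by (simp add: G_def)
    consider "y < c" | "c \<le> y" "y \<le> T" | "T < y" by linarith
    then show ?thesis
    proof cases
      case 1
      then have "\<psi> T * k y \<le> \<psi> T * G y" using \<psi>T kG by (intro mult_left_mono)
      also have "\<dots> \<le> \<psi> T * G y + y powr q * k y" using k(1)[of y] by simp
      finally show ?thesis using 1 True c by (simp add: half_moment_fun_def)
    next
      case 2
      have "(\<psi> T - \<psi> y) * k y \<le> (\<psi> T - \<psi> y) * G y"
        using kG \<psi>_mono[OF 2(2)] by (intro mult_left_mono) auto
      moreover have "\<psi> y * k y \<le> y powr q * k y" using \<psi>_le[OF 2(1)] k(1) by (rule mult_right_mono)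
      ultimately show ?thesis using 2 True by (simp add: half_moment_fun_def algebra_simps)
    next
      case 3
      then have "\<psi> T \<le> y powr q" using \<psi>_mono[of T y] \<psi>_le[of y] c by auto
      then have "\<psi> T * k y \<le> y powr q * k y" using k(1) by (rule mult_right_mono)
      then show ?thesis using 3 True by (simp add: half_moment_fun_def)
    qed
  next
    case False
    then show ?thesis using that c by (simp add: half_moment_fun_def indicator_def)
  qed
  then have "AE y in lborel. ?R y \<le> half_moment_fun k q y"
    using AE_lborel_singleton[of 0] by (auto elim: eventually_mono)
  then have "integral\<^sup>L lborel ?R \<le> half_moment k q"
    unfolding half_moment_def using R kq by (intro integral_mono_AE) (auto simp: has_bochner_integral_iff)
  also have "integral\<^sup>L lborel ?R = m * cq * exp a * (1 + q * (a - b - 1) / b) - m * cq * exp b * (1 + q * (- 1) / b)"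
    using R unfolding c by (simp add: has_bochner_integral_iff algebra_simps)
  also have "\<dots> = m * (b / \<mu>) powr q * (exp a * (1 + q * (a - b - 1) / b) - exp b * (1 - q / b))"
    by (simp add: cq_def c_def algebra_simps)
  finally show ?thesis .
qed

text \<open>The coefficient of 1/w is e^t (t - 1) + 1 \<ge> 0, so S = 18/5 and w = 1/3 are the worst
  case. Dividing by e^t leaves e \<le> (28/5) e^(-t) + 3t - 2. The right-hand side is smallest where
  e^(-t) = 15/28, close to t = 3/5; bounding e^(-t) by a line of slope -15/28 cancels t and leaves
  14/5 > e.\<close>

lemma exp_lower_numeric:
  fixes t w S :: real
  assumes t: "t \<ge> 0" and w: "0 < w" "w \<le> 1/3" and S: "S \<ge> 18/5"
  shows "exp (t + 1) \<le> S + exp t * (1 + (t - 1) / w) - 1 + 1 / w"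
proof -
  have e: "exp 1 \<le> (272/100 :: real)" using e_less_272 by simp
  \<comment> \<open>The fifth power reduces the comparison of e^(3/5) with 28/15 to a rational bound
    on e^3.\<close>
  have "exp (3/5) ^ 5 = (exp 1 :: real) ^ 3"
    by (simp flip: exp_of_nat_mult)
  also have "\<dots> \<le> (272/100) ^ 3" using e by (intro power_mono) auto
  also have "\<dots> \<le> (28/15 :: real) ^ 5" by (simp add: power_divide)
  finally have "exp (3/5) \<le> (28/15 :: real)" by (subst (asm) power_mono_iff) auto
  then have "(15/28) * 1 \<le> exp (- (3/5)) * (1::real)" by (simp add: exp_minus divide_simps)
  moreover have "8/5 - t \<le> exp (3/5 - t)" using exp_ge_add_one_self[of "3/5 - t"] by simp
  ultimately have "(15/28) * exp (3/5 - t) \<le> exp (- (3/5)) * exp (3/5 - t)"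
    by (intro mult_right_mono) auto
  then have "(15/28) * exp (3/5 - t) \<le> exp (- t)" by (simp flip: exp_add)
  moreover have "(15/28) * (8/5 - t) \<le> (15/28) * exp (3/5 - t)"
    using \<open>8/5 - t \<le> exp (3/5 - t)\<close> by (rule mult_left_mono) simp
  ultimately have "(15/28) * (8/5 - t) \<le> exp (- t)" by (rule order_trans[rotated])
  moreover have "y \<le> 28/5 * x + 3 * t - 2" if "(15/28) * (8/5 - t) \<le> x" "y \<le> 272/100" for x y :: real
    using that by (simp add: field_simps)
  ultimately have "exp 1 \<le> 28/5 * exp (- t) + 3 * t - 2" using e by blast
  then have "exp t * exp 1 \<le> exp t * (28/5 * exp (- t) + 3 * t - 2)" by (intro mult_left_mono) auto
  also have "\<dots> = 18/5 + exp t + 3 * (exp t * (t - 1) + 1) - 1"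
    by (simp add: algebra_simps exp_minus)
  also have "3 * (exp t * (t - 1) + 1) \<le> (1 / w) * (exp t * (t - 1) + 1)"
  proof (rule mult_right_mono)
    have "1 - t \<le> exp (- t)" using exp_ge_add_one_self[of "- t"] by simp
    then have "exp t * (1 - t) \<le> exp t * exp (- t)" by (intro mult_left_mono) auto
    then show "0 \<le> exp t * (t - 1) + 1" by (simp add: algebra_simps flip: exp_add)
  qed (use w in \<open>simp add: divide_simps\<close>)
  finally show ?thesis using S by (simp add: exp_add algebra_simps add_divide_distrib diff_divide_distrib)
qed

section \<open>The moment comparison for densities\<close>


lemma positive_side_moment_ratio_le:
  fixes f :: "real \<Rightarrow> real"
  defines "f' \<equiv> \<lambda>x. f (- x)"
  assumes f: "log_concave f" "f \<in> borel_measurable borel"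
    and I0: "integrable lborel (half_moment_fun f 0)" "integrable lborel (half_moment_fun f' 0)"
    and Iq: "integrable lborel (half_moment_fun f q)" "integrable lborel (half_moment_fun f' q)"
    and prob: "half_moment f 0 + half_moment f' 0 = 1"
    and m: "half_moment f 0 > 0" and q: "q \<ge> 2"
    and w: "w > 0" "w \<le> 1/3" "w * exp w = exp (- 1)"
  shows "half_moment f q / half_moment f 0
          \<le> (half_moment f q + half_moment f' q) * (exp (w * q - 1) * stirling_ratio q)"
proof -
  define m where "m = half_moment f 0"
  define S where "S = stirling_ratio q"
  define M where "M = half_moment f q + half_moment f' q"
  have nonneg: "half_moment f s \<ge> 0" "half_moment f' s \<ge> 0" for s
    unfolding half_moment_def half_moment_fun_def f'_def
    using log_concave_nonneg[OF f(1)] by (auto intro!: Bochner_Integration.integral_nonneg)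
  have m0: "0 < m" "m \<le> 1" using m prob nonneg[of 0] by (auto simp: m_def)
  have S: "S \<ge> 18/5" unfolding S_def using q by (rule stirling_ratio_ge)
  obtain \<mu> where \<mu>: "\<mu> > 0" "half_moment f q = m * Gamma (q + 1) / \<mu> powr q"
    "\<And>y. y \<le> 0 \<Longrightarrow> f y \<le> m * \<mu> * exp (- \<mu> * y)"
    using log_concave_half_line[OF f I0(1) Iq(1) m] q unfolding m_def by (metis less_le_trans zero_less_numeral)
  \<comment> \<open>With this a the remaining mass is 1 - m = m (e^a - 1), exactly the mass of m
    \<mu> e^(\<mu>y) on [0, a/\<mu>].\<close>
  define a where "a = - ln m"
  have a: "a \<ge> 0" "m = exp (- a)" using m0 by (auto simp: a_def)
  have "half_moment f q / m * exp (1 - w * q) \<le> M * S"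
  proof (cases "a \<le> w * q")
    \<comment> \<open>Now 1/m = e^a \<le> e^(wq), and the positive side is part of E|X|^q; the
      leftover factor e is below S.\<close>
    case True
    have "half_moment f q / m * exp (1 - w * q) = half_moment f q * (exp (a - w * q) * exp 1)"
      by (simp add: a exp_minus divide_inverse flip: exp_add)
    also have "\<dots> \<le> M * S"
    proof (rule mult_mono)
      have "exp (a - w * q) * exp 1 \<le> 1 * exp 1" using True by (intro mult_right_mono) auto
      also have "\<dots> \<le> S" using S e_less_272 by simp
      finally show "exp (a - w * q) * exp 1 \<le> S" .
    qed (use nonneg[of q] in \<open>auto simp: M_def\<close>)
    finally show ?thesis .
  next
    case False
    define t where "t = a - w * q"
    \<comment> \<open>The positive-side moment without its factor S. The tangent point b = wq is
      chosen so that Q is also the prefactor of the bound for the negative side; after dividing by Q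
      only the numerical inequality in t remains.\<close>
    define Q where "Q = m * (q / exp 1) powr q / \<mu> powr q"
    have Q: "Q \<ge> 0" using m0 by (simp add: Q_def)
    have \<alpha>: "half_moment f q = Q * S"
      using q by (simp add: \<mu>(2) Gamma_eq_stirling_ratio Q_def S_def mult_ac)
    have "m * (exp a - 1) = half_moment f' 0"
      using prob by (simp add: m_def[symmetric] a(2) algebra_simps flip: exp_add)
    then have f'0: "has_bochner_integral lborel (half_moment_fun f' 0) (m * (exp a - 1))"
      using I0(2) by (simp add: has_bochner_integral_iff half_moment_def)
    have "m * (w * q / \<mu>) powr q * (exp a * (1 + q * (a - w * q - 1) / (w * q)) - exp (w * q) * (1 - q / (w * q)))
        \<le> half_moment f' q"
      using \<mu>(3)[of "- y" for y] log_concave_nonneg[OF f(1)] m0 \<mu>(1) w q False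
      by (intro moment_ge_truncated_exp[OF _ _ f'0 Iq(2)]) (auto simp: f'_def)
    also have "q * (a - w * q - 1) / (w * q) = (t - 1) / w" using q by (simp add: t_def)
    also have "q / (w * q) = 1 / w" using q by simp
    also have "exp a = exp (w * q) * exp t" by (simp add: t_def flip: exp_add)
    also have "m * (w * q / \<mu>) powr q * (exp (w * q) * exp t * (1 + (t - 1) / w) - exp (w * q) * (1 - 1 / w))
        = (m * (w * q / \<mu>) powr q * exp (w * q)) * (exp t * (1 + (t - 1) / w) - 1 + 1 / w)"
      by (simp add: algebra_simps)
    \<comment> \<open>The only use of the equation w e^w = 1/e in this estimate.\<close>
    also have "m * (w * q / \<mu>) powr q * exp (w * q) = Q"
    proof -
      have "w powr q * exp (w * q) = (w * exp w) powr q" by (simp only: powr_mult exp_powr_real)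
      also have "\<dots> = 1 / exp 1 powr q" unfolding w(3) exp_powr_real by (simp add: exp_minus divide_inverse)
      finally show ?thesis by (simp add: Q_def powr_mult powr_divide mult_ac)
    qed
    finally have "Q * (S + exp t * (1 + (t - 1) / w) - 1 + 1 / w) \<le> M"
      unfolding M_def \<alpha> by (simp add: algebra_simps)
    moreover have "Q * exp (t + 1) \<le> Q * (S + exp t * (1 + (t - 1) / w) - 1 + 1 / w)"
      using Q False w S by (intro mult_left_mono exp_lower_numeric) (auto simp: t_def)
    ultimately have "Q * exp (t + 1) * S \<le> M * S" using S by (intro mult_right_mono) auto
    moreover have "exp (1 - w * q) / m = exp (t + 1)"
      by (simp add: a(2) t_def exp_minus divide_inverse flip: exp_add)
    then have "half_moment f q / m * exp (1 - w * q) = Q * exp (t + 1) * S"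
      unfolding \<alpha> by (metis mult.assoc mult.commute times_divide_eq_left times_divide_eq_right)
    ultimately show ?thesis by simp
  qed
  then have "half_moment f q / m * exp (1 - w * q) * exp (w * q - 1) \<le> M * S * exp (w * q - 1)"
    by (intro mult_right_mono) auto
  then show ?thesis
    by (simp add: M_def S_def m_def mult_ac flip: exp_add)
qed

lemma half_line_moment_le:
  assumes f: "log_concave f" "f \<in> borel_measurable borel"
    and I: "integrable lborel (half_moment_fun f 0)" "integrable lborel (half_moment_fun f q)"
    and q: "0 < q" "q < p"
  shows "integrable lborel (half_moment_fun f p)"
    and "half_moment f p \<le> Gamma (p + 1) / Gamma (q + 1) powr (p / q) *
           (half_moment f 0 * (half_moment f q / half_moment f 0) powr (p / q))"
proof -
  have nonneg: "half_moment_fun f 0 x \<ge> 0" for x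
    using log_concave_nonneg[OF f(1)] by (simp add: half_moment_fun_def)
  have "integrable lborel (half_moment_fun f p) \<and> half_moment f p \<le> Gamma (p + 1) / Gamma (q + 1) powr (p / q) *
           (half_moment f 0 * (half_moment f q / half_moment f 0) powr (p / q))"
  proof (cases "half_moment f 0 > 0")
    case True
    obtain \<mu> where \<mu>: "\<mu> > 0" "half_moment f q = half_moment f 0 * Gamma (q + 1) / \<mu> powr q"
      "integrable lborel (half_moment_fun f p)"
      "half_moment f p \<le> half_moment f 0 * Gamma (p + 1) / \<mu> powr p"
      using log_concave_half_line[OF f I True q(1)] q(2) by metis
    have G: "Gamma (q + 1) > 0" using q by (intro Gamma_real_pos) auto
    have "half_moment f q / half_moment f 0 = Gamma (q + 1) / \<mu> powr q"
      using True by (simp add: \<mu>(2))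
    then have "(half_moment f q / half_moment f 0) powr (p / q) = Gamma (q + 1) powr (p / q) / \<mu> powr p"
      using q by (simp add: powr_divide powr_powr)
    then show ?thesis using \<mu>(3,4) G by (simp add: mult_ac)
  next
    case False
    then have "half_moment f 0 = 0"
      unfolding half_moment_def using nonneg by (simp add: not_less order_antisym)
    then have "AE x in lborel. half_moment_fun f 0 x = 0"
      using I(1) nonneg by (subst integral_nonneg_eq_0_iff_AE[symmetric]) (auto simp: half_moment_def)
    then have AE: "AE x in lborel. half_moment_fun f p x = 0"
      by eventually_elim (auto simp: half_moment_fun_def indicator_def split: if_splits)
    have "integrable lborel (half_moment_fun f p) \<longleftrightarrow> integrable lborel (\<lambda>x::real. 0 :: real)"
      by (rule integrable_cong_AE[OF _ _ AE]) (use f(2) in auto)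
    then have "integrable lborel (half_moment_fun f p)" by simp
    moreover have "half_moment f p = 0" unfolding half_moment_def using AE by (rule integral_eq_zero_AE)
    ultimately show ?thesis using \<open>half_moment f 0 = 0\<close> by simp
  qed
  then show "integrable lborel (half_moment_fun f p)"
    "half_moment f p \<le> Gamma (p + 1) / Gamma (q + 1) powr (p / q) *
           (half_moment f 0 * (half_moment f q / half_moment f 0) powr (p / q))" by auto
qed

text \<open>The powers of S(q) collapse, leaving (S(p)/S(q)) l^p e^((wq - 1)(l - 1)) with l = p/q.
  The -1 in the exponent pays exactly for S(p)/S(q) \<le> l \<le> e^(l - 1).\<close>

lemma moment_constant_le:
  fixes w :: real
  assumes w: "w > 0" and q: "q \<ge> 2" "q < p"
  shows "Gamma (p + 1) / Gamma (q + 1) powr (p / q) * (exp (w * q - 1) * stirling_ratio q) powr (p / q - 1)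
           \<le> (exp w * (p / q)) powr p"
proof -
  define l where "l = p / q"
  have l: "l > 1" "p = l * q" using q by (auto simp: l_def)
  define Sp Sq where "Sp = stirling_ratio p" and "Sq = stirling_ratio q"
  have S: "Sp > 0" "Sq > 0" using q by (auto simp: Sp_def Sq_def stirling_ratio_pos)
  have "(exp (w * q - 1) * Sq) powr (l - 1) = exp ((w * q - 1) * (l - 1)) * (Sq powr l / Sq)"
    unfolding powr_mult exp_powr_real using S by (simp add: powr_diff)
  then have "Gamma (p + 1) / Gamma (q + 1) powr l * (exp (w * q - 1) * Sq) powr (l - 1)
     = Sp * (p / exp 1) powr p / (Sq powr l * (q / exp 1) powr p) * (exp ((w * q - 1) * (l - 1)) * (Sq powr l / Sq))"
    using q S l by (simp add: Gamma_eq_stirling_ratio Sp_def Sq_def powr_mult powr_powr mult_ac)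
  also have "\<dots> = (Sp / Sq) * ((p / exp 1) powr p / (q / exp 1) powr p) * exp ((w * q - 1) * (l - 1))"
    using S by (simp add: mult_ac)
  also have "(p / exp 1) powr p / (q / exp 1) powr p = l powr p"
    using q by (simp add: l_def powr_divide)
  also have "(Sp / Sq) * l powr p * exp ((w * q - 1) * (l - 1))
      \<le> exp (l - 1) * l powr p * exp ((w * q - 1) * (l - 1))"
  proof (intro mult_right_mono)
    have "Sp \<le> l * Sq" unfolding Sp_def Sq_def l_def using q by (intro stirling_ratio_le) auto
    then have "Sp / Sq \<le> l" using S by (simp add: divide_simps)
    also have "l \<le> exp (l - 1)" using exp_ge_add_one_self[of "l - 1"] by simp
    finally show "Sp / Sq \<le> exp (l - 1)" .
  qed auto
  also have "\<dots> = l powr p * exp (w * q * (l - 1))"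
    by (simp add: algebra_simps flip: exp_add)
  also have "\<dots> \<le> l powr p * exp (w * q * l)"
    using w q by (intro mult_left_mono) auto
  also have "\<dots> = (exp w * l) powr p"
    by (simp add: powr_mult exp_powr_real l(2) mult_ac)
  finally show ?thesis by (simp add: l_def Sq_def)
qed

text \<open>A side of mass $0$ has quotient $0$ by the convention on division, so the hypothesis on the
  quotients rules out that $f$ vanishes on the positive side.\<close>

lemma abs_moment_le_if_positive_side_dominates:
  fixes f :: "real \<Rightarrow> real"
  defines "f' \<equiv> \<lambda>x. f (- x)"
  assumes f: "log_concave f" "f \<in> borel_measurable borel"
    and I0: "integrable lborel (half_moment_fun f 0)" "integrable lborel (half_moment_fun f' 0)"
    and Iq: "integrable lborel (half_moment_fun f q)" "integrable lborel (half_moment_fun f' q)"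
    and prob: "half_moment f 0 + half_moment f' 0 = 1"
    and q: "q \<ge> 2" "q < p"
    and le: "half_moment f' q / half_moment f' 0 \<le> half_moment f q / half_moment f 0"
  shows "half_moment f p + half_moment f' p
    \<le> (C0 * (p / q)) powr p * (half_moment f q + half_moment f' q) powr (p / q)"
proof -
  obtain w where w: "w > 0" "w \<le> 1/3" "w * exp w = exp (-1)" "C0 = exp w" by (rule C0_eq_exp)
  have f': "log_concave f'" "f' \<in> borel_measurable borel"
    using f by (auto simp: f'_def log_concave_reflect)
  define m m' \<alpha> \<beta> u v M E \<Gamma> l where defs: "m = half_moment f 0" "m' = half_moment f' 0"
    "\<alpha> = half_moment f q" "\<beta> = half_moment f' q" "u = \<alpha> / m" "v = \<beta> / m'" "M = \<alpha> + \<beta>"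
    "E = exp (w * q - 1) * stirling_ratio q" "\<Gamma> = Gamma (p + 1) / Gamma (q + 1) powr (p / q)" "l = p / q"
  have l: "l > 1" using q by (simp add: defs)
  have nonneg: "half_moment f s \<ge> 0" "half_moment f' s \<ge> 0" for s
    unfolding half_moment_def half_moment_fun_def
    using log_concave_nonneg[OF f(1)] log_concave_nonneg[OF f'(1)]
    by (auto intro!: Bochner_Integration.integral_nonneg)
  have nn: "m \<ge> 0" "m' \<ge> 0" "\<alpha> \<ge> 0" "\<beta> \<ge> 0" "u \<ge> 0" "v \<ge> 0" "M \<ge> 0" "E \<ge> 0" "\<Gamma> \<ge> 0"
    using nonneg q stirling_ratio_pos[of q] Gamma_real_pos[of "p + 1"] by (auto simp: defs)
  have m: "m > 0"
  proof (rule ccontr)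
    assume "\<not> m > 0"
    then have "m = 0" "m' > 0" using prob nn by (auto simp: defs)
    then have "\<beta> > 0" unfolding defs using half_moment_pos[OF log_concave_nonneg[OF f'(1)] Iq(2)] by blast
    then have "v > 0" using \<open>m' > 0\<close> by (simp add: defs)
    moreover have "v \<le> u" using le by (simp add: defs)
    ultimately show False using \<open>m = 0\<close> by (simp add: defs)
  qed
  have uM: "u \<le> M * E"
    unfolding defs f'_def by (rule positive_side_moment_ratio_le) (use f I0 Iq prob q m w in \<open>auto simp: defs f'_def\<close>)
  have "half_moment f p + half_moment f' p \<le> \<Gamma> * (m * u powr l) + \<Gamma> * (m' * v powr l)"
    unfolding defs
    using half_line_moment_le(2)[OF f I0(1) Iq(1)] half_line_moment_le(2)[OF f' I0(2) Iq(2)] q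
    by (intro add_mono) auto
  also have "\<dots> = \<Gamma> * (m * u powr l + m' * v powr l)" by (simp add: algebra_simps)
  also have "\<dots> \<le> \<Gamma> * (M * (M * E) powr (l - 1))"
  proof (rule mult_left_mono)
    \<comment> \<open>One factor of u^l turns m back into the moment, m u = \<alpha>; the remaining
      power l - 1 is bounded through u \<le> M E, and likewise for v \<le> u.\<close>
    have pe: "x powr l = x * x powr (l - 1)" if "x \<ge> 0" for x :: real
      using that by (cases "x = 0") (auto simp: powr_diff)
    have "m * u powr l \<le> \<alpha> * (M * E) powr (l - 1)"
    proof -
      have "m * u powr l = \<alpha> * u powr (l - 1)" using m nn pe[of u] by (simp add: defs(5))
      also have "\<dots> \<le> \<alpha> * (M * E) powr (l - 1)"
        using nn l uM by (intro mult_left_mono powr_mono2) auto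
      finally show ?thesis .
    qed
    moreover have "m' * v powr l \<le> \<beta> * (M * E) powr (l - 1)"
    proof -
      \<comment> \<open>Since m' may be 0, in which case v = 0, only m' v \<le> \<beta> is
        used.\<close>
      have "m' * v powr l = (m' * v) * v powr (l - 1)" using nn pe[of v] by simp
      also have "\<dots> \<le> \<beta> * (M * E) powr (l - 1)"
        using nn l uM le by (intro mult_mono powr_mono2) (auto simp: defs)
      finally show ?thesis .
    qed
    ultimately show "m * u powr l + m' * v powr l \<le> M * (M * E) powr (l - 1)"
      unfolding defs(7) by (simp add: algebra_simps)
  qed (use nn in auto)
  also have "\<dots> = (\<Gamma> * E powr (l - 1)) * M powr l"
    using nn l by (cases "M = 0") (auto simp: powr_mult powr_diff)
  also have "\<dots> \<le> (C0 * (p / q)) powr p * M powr l"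
    unfolding w(4) using moment_constant_le[OF w(1) q] by (intro mult_right_mono) (auto simp: defs)
  finally show ?thesis by (simp add: defs)
qed

lemma abs_moment_le:
  fixes f :: "real \<Rightarrow> real"
  defines "f' \<equiv> \<lambda>x. f (- x)"
  assumes f: "log_concave f" "f \<in> borel_measurable borel"
    and I0: "integrable lborel (half_moment_fun f 0)" "integrable lborel (half_moment_fun f' 0)"
    and Iq: "integrable lborel (half_moment_fun f q)" "integrable lborel (half_moment_fun f' q)"
    and prob: "half_moment f 0 + half_moment f' 0 = 1"
    and q: "q \<ge> 2" "q < p"
  shows "half_moment f p + half_moment f' p
    \<le> (C0 * (p / q)) powr p * (half_moment f q + half_moment f' q) powr (p / q)"
proof (cases "half_moment f' q / half_moment f' 0 \<le> half_moment f q / half_moment f 0")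
  case True
  then show ?thesis using assms unfolding f'_def by (intro abs_moment_le_if_positive_side_dominates) auto
next
  case False
  have f': "log_concave f'" "f' \<in> borel_measurable borel"
    using f by (auto simp: f'_def log_concave_reflect)
  show ?thesis
    using abs_moment_le_if_positive_side_dominates[OF f', of q p] False I0 Iq prob q by (simp add: f'_def add_ac)
qed

section \<open>Shifted exponential variables\<close>


lemma L_norm_ge:
  assumes "s > 0" "r \<ge> 0" "ennreal r \<le> (\<integral>\<^sup>+ \<omega>. ennreal (\<bar>X \<omega>\<bar> powr s) \<partial>M)"
  shows "ereal (r powr (1 / s)) \<le> L_norm M s X"
  using assms by (cases "\<integral>\<^sup>+ \<omega>. ennreal (\<bar>X \<omega>\<bar> powr s) \<partial>M")
    (auto simp: L_norm_def Let_def intro!: powr_mono2)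

lemma L_norm_le:
  assumes "s > 0" "r \<ge> 0" "(\<integral>\<^sup>+ \<omega>. ennreal (\<bar>X \<omega>\<bar> powr s) \<partial>M) \<le> ennreal r"
  shows "L_norm M s X \<le> ereal (r powr (1 / s))"
  using assms by (cases "\<integral>\<^sup>+ \<omega>. ennreal (\<bar>X \<omega>\<bar> powr s) \<partial>M")
    (auto simp: L_norm_def Let_def top_unique intro!: powr_mono2)

lemma L_norm_nonneg: "0 \<le> L_norm M s X"
  by (simp add: L_norm_def Let_def)

definition shifted_exp_potential :: "real \<Rightarrow> real \<Rightarrow> ereal" where
  "shifted_exp_potential a x = (if - a \<le> x then ereal (x + a) else \<infinity>)"

text \<open>The law of T - a for a standard exponential T; the random variable is the
  identity.\<close>

definition shifted_exp :: "real \<Rightarrow> real measure" where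
  "shifted_exp a = density lborel (\<lambda>x. exp_neg (shifted_exp_potential a x))"

lemma exp_neg_shifted_exp_potential:
  "exp_neg (shifted_exp_potential a x) = ennreal (indicator {- a..} x * exp (- x - a))"
  by (simp add: exp_neg_def shifted_exp_potential_def)

lemma extended_convex_shifted_exp_potential: "extended_convex (shifted_exp_potential a)"
  unfolding extended_convex_def
proof (intro conjI allI impI)
  fix x y t :: real assume t: "0 \<le> t \<and> t \<le> 1"
  let ?V = "shifted_exp_potential a"
  consider "t = 0" | "t = 1" | "0 < t" "t < 1" "x < - a \<or> y < - a" | "- a \<le> x" "- a \<le> y"
    using t by linarith
  then show "?V ((1 - t) * x + t * y) \<le> ereal (1 - t) * ?V x + ereal t * ?V y"
  proof cases
    case 3
    have top: "ereal (1 - t) * ?V x + ereal t * ?V y = \<infinity>"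
      by (cases "- a \<le> x"; cases "- a \<le> y") (use 3 in \<open>auto simp: shifted_exp_potential_def\<close>)
    show ?thesis unfolding top by simp
  next
    case 4
    have "(1 - t) * (- a) + t * (- a) \<le> (1 - t) * x + t * y"
      using 4 t by (intro add_mono mult_left_mono) auto
    then have "- a \<le> (1 - t) * x + t * y" by (simp add: algebra_simps)
    then show ?thesis using 4 by (simp add: shifted_exp_potential_def algebra_simps)
  qed (auto simp flip: zero_ereal_def one_ereal_def)
qed (simp add: shifted_exp_potential_def)

lemma nn_integral_shifted_exp:
  assumes [measurable]: "h \<in> borel_measurable borel"
  shows "(\<integral>\<^sup>+ x. h x \<partial>shifted_exp a) = (\<integral>\<^sup>+ x. ennreal (indicator {- a..} x * exp (- x - a)) * h x \<partial>lborel)"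
  unfolding shifted_exp_def exp_neg_shifted_exp_potential
  by (subst nn_integral_density) auto

lemma total_shifted_exp: "(\<integral>\<^sup>+ x. ennreal (indicator {- a..} x * exp (- x - a)) \<partial>lborel) = 1"
proof -
  have "(\<integral>\<^sup>+ x. ennreal (indicator {- a..} x * exp (- x - a)) \<partial>lborel)
      = (\<integral>\<^sup>+ x. ennreal (indicator {- a..} (- a + 1 * x) * exp (- (- a + 1 * x) - a)) \<partial>lborel)"
    by (subst nn_integral_real_affine[where c = 1 and t = "- a"]) auto
  also have "\<dots> = (\<integral>\<^sup>+ x. ennreal (indicator {0..} x * x powr (1 - 1) / exp x) \<partial>lborel)"
    by (rule nn_integral_cong_AE, rule AE_mp[OF AE_lborel_singleton[of 0]])
       (auto simp: indicator_def exp_minus divide_inverse)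
  also have "\<dots> = 1" by (subst Gamma_conv_nn_integral_real[symmetric]) auto
  finally show ?thesis .
qed

lemma prob_space_shifted_exp: "prob_space (shifted_exp a)"
proof
  have "emeasure (shifted_exp a) (space (shifted_exp a)) = (\<integral>\<^sup>+ x. 1 \<partial>shifted_exp a)" by simp
  also have "\<dots> = 1"
    by (subst nn_integral_shifted_exp) (simp_all add: total_shifted_exp)
  finally show "emeasure (shifted_exp a) (space (shifted_exp a)) = 1" .
qed

lemma log_concave_rv_shifted_exp: "log_concave_rv (shifted_exp a) (\<lambda>x. x)"
proof -
  have s: "sets (shifted_exp a) = sets borel" by (simp add: shifted_exp_def)
  then have "distr (shifted_exp a) lborel (\<lambda>x. x) = shifted_exp a" by (intro distr_id2) simp
  then have "distributed (shifted_exp a) lborel (\<lambda>x. x) (\<lambda>x. exp_neg (shifted_exp_potential a x))"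
    unfolding distributed_def by (simp add: shifted_exp_def exp_neg_shifted_exp_potential)
  moreover have "(\<lambda>x. x) \<in> borel_measurable (shifted_exp a)"
    by (rule measurable_ident_sets[OF s])
  ultimately show ?thesis
    unfolding log_concave_rv_def using extended_convex_shifted_exp_potential by blast
qed

lemma nn_integral_half_moment_exp:
  assumes "s \<ge> 0" "K \<ge> 0"
  shows "(\<integral>\<^sup>+ x. ennreal (half_moment_fun (\<lambda>x. K * exp (- x)) s x) \<partial>lborel) = ennreal (K * Gamma (s + 1))"
  using half_moment_fun_exp[OF assms(1), of 1 K] assms(2)
  by (subst nn_integral_eq_integral) (auto simp: has_bochner_integral_iff half_moment_fun_def)

text \<open>By memorylessness the part on x > 0 is again exponential, with mass e^(-a); the rest is
  dropped.\<close>

lemma shifted_exp_moment_ge: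
  assumes "s \<ge> 0" "a \<ge> 0"
  shows "ennreal (exp (- a) * Gamma (s + 1)) \<le> (\<integral>\<^sup>+ x. ennreal (\<bar>x\<bar> powr s) \<partial>shifted_exp a)"
  unfolding nn_integral_half_moment_exp[OF assms(1) exp_ge_zero, symmetric]
  using assms
  by (subst nn_integral_shifted_exp)
     (auto intro!: nn_integral_mono simp: half_moment_fun_def exp_diff exp_minus divide_inverse mult_ac
       simp flip: ennreal_mult split: split_indicator)

lemma shifted_exp_moment_le:
  assumes "s \<ge> 0" "a \<ge> 0"
  shows "(\<integral>\<^sup>+ x. ennreal (\<bar>x\<bar> powr s) \<partial>shifted_exp a) \<le> ennreal (exp (- a) * Gamma (s + 1) + a powr s)"
proof -
  let ?d = "\<lambda>x. indicator {- a..} x * exp (- x - a)"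
  have "(\<integral>\<^sup>+ x. ennreal (\<bar>x\<bar> powr s) \<partial>shifted_exp a) = (\<integral>\<^sup>+ x. ennreal (?d x) * ennreal (\<bar>x\<bar> powr s) \<partial>lborel)"
    by (rule nn_integral_shifted_exp) simp
  also have "\<dots> \<le> (\<integral>\<^sup>+ x. ennreal (half_moment_fun (\<lambda>x. exp (- a) * exp (- x)) s x) + ennreal (a powr s) * ennreal (?d x) \<partial>lborel)"
  proof (rule nn_integral_mono)
    fix x :: real
    have "?d x * \<bar>x\<bar> powr s \<le> half_moment_fun (\<lambda>x. exp (- a) * exp (- x)) s x + a powr s * ?d x"
    proof (cases "x > 0")
      case True
      then show ?thesis using assms by (simp add: half_moment_fun_def exp_diff exp_minus divide_inverse mult_ac)
    next
      case False
      then show ?thesis using assms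
        by (auto simp: half_moment_fun_def indicator_def mult.commute intro!: mult_left_mono powr_mono2)
    qed
    then show "ennreal (?d x) * ennreal (\<bar>x\<bar> powr s)
        \<le> ennreal (half_moment_fun (\<lambda>x. exp (- a) * exp (- x)) s x) + ennreal (a powr s) * ennreal (?d x)"
      by (simp add: half_moment_fun_def flip: ennreal_mult ennreal_plus)
  qed
  also have "\<dots> = ennreal (exp (- a) * Gamma (s + 1)) + ennreal (a powr s) * 1"
    using assms total_shifted_exp[of a]
    by (subst nn_integral_add) (auto simp: nn_integral_cmult nn_integral_half_moment_exp)
  also have "\<dots> = ennreal (exp (- a) * Gamma (s + 1) + a powr s)"
    using assms Gamma_real_pos[of "s + 1"] by simp
  finally show ?thesis .
qed

lemma C0_le:
  fixes C :: real
  assumes C: "\<And>(N :: real measure) (Y :: real \<Rightarrow> real) p q. prob_space N \<Longrightarrow> log_concave_rv N Y \<Longrightarrow> p > q \<Longrightarrow> q \<ge> 2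
      \<Longrightarrow> L_norm N p Y \<le> ereal (C * (p / q)) * L_norm N q Y"
  shows "C0 \<le> C"
proof -
  obtain w where w: "w > 0" "w \<le> 1/3" "w * exp w = exp (-1)" "C0 = exp w" by (rule C0_eq_exp)
  have bound: "exp (w - w / q) \<le> C * (q * exp 1 + 1) powr (1 / q)" if q: "q \<ge> 2" for q
  proof -
    \<comment> \<open>The shift wq makes a^q equal to e^(-a) (q/e)^q, so both terms bounding the
      q-th moment have the same exponential order and the q-norm is about e^(-w) q/e. With p = q^2
      the loss e^(-a/p) = e^(-w/q) in the p-norm tends to 1.\<close>
    define p a where "p = q * q" and "a = w * q"
    have p: "p > q" using q by (simp add: p_def)
    have a: "a \<ge> 0" using w q by (simp add: a_def)
    define l where "l = (exp (- a) * Gamma (p + 1)) powr (1 / p)"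
    define r where "r = (exp (- a) * Gamma (q + 1) + a powr q) powr (1 / q)"
    have G: "Gamma (p + 1) > 0" "Gamma (q + 1) > 0" using q p by (auto intro!: Gamma_real_pos)
    have l: "ereal l \<le> L_norm (shifted_exp a) p (\<lambda>x. x)"
      unfolding l_def using p q G a by (intro L_norm_ge shifted_exp_moment_ge) auto
    have r: "L_norm (shifted_exp a) q (\<lambda>x. x) \<le> ereal r"
      unfolding r_def using p q G a by (intro L_norm_le shifted_exp_moment_le) auto
    have l0: "l > 0" using G by (simp add: l_def)
    obtain x where x: "L_norm (shifted_exp a) q (\<lambda>x. x) = ereal x" "0 \<le> x" "x \<le> r"
      using r L_norm_nonneg[of "shifted_exp a" q "\<lambda>x. x"]
      by (cases "L_norm (shifted_exp a) q (\<lambda>x. x)") auto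
    have "ereal l \<le> ereal (C * (p / q)) * ereal x"
      using order_trans[OF l C[OF prob_space_shifted_exp log_concave_rv_shifted_exp p q]]
      unfolding x(1) .
    then have lx: "l \<le> C * (p / q) * x" by simp
    have C0: "C > 0"
    proof (rule ccontr)
      assume "\<not> C > 0"
      then have "C * (p / q) * x \<le> 0" using p q x(2) by (intro mult_nonpos_nonneg) auto
      then show False using lx l0 by simp
    qed
    have "C * (p / q) * x \<le> C * (p / q) * r"
      using x C0 p q by (intro mult_left_mono) auto
    with lx have lr: "l \<le> C * (p / q) * r" by simp
    have "1 \<le> stirling_ratio p" using stirling_ratio_ge[of p] p q by simp
    have "exp (- w / q) * (p / exp 1) = (exp (- a) * (p / exp 1) powr p) powr (1 / p)"
      unfolding powr_mult exp_powr_real using q by (simp add: powr_powr a_def p_def)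
    also have "\<dots> \<le> l"
      unfolding l_def using p q \<open>1 \<le> stirling_ratio p\<close>
      by (intro powr_mono2) (auto simp: Gamma_eq_stirling_ratio)
    finally have 1: "exp (- w / q) * (p / exp 1) \<le> l" .
    have "a powr q = exp (- a) * (q / exp 1) powr q"
    proof -
      have "a powr q * exp a = (w * exp w) powr q * q powr q"
        unfolding a_def powr_mult exp_powr_real by simp
      also have "\<dots> = (q / exp 1) powr q"
        using q unfolding w(3) exp_powr_real powr_divide by (simp add: exp_powr_real exp_minus divide_inverse)
      finally show ?thesis by (simp add: exp_minus field_simps)
    qed
    then have "r = (exp (- a) * (q / exp 1) powr q * (stirling_ratio q + 1)) powr (1 / q)"
      using q unfolding r_def by (subst Gamma_eq_stirling_ratio) (auto simp: algebra_simps)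
    also have "\<dots> = exp (- w) * (q / exp 1) * (stirling_ratio q + 1) powr (1 / q)"
      unfolding powr_mult exp_powr_real using q by (simp add: powr_powr a_def)
    \<comment> \<open>S(q) \<le> q S(1) = q e, whose q-th root tends to 1.\<close>
    also have "\<dots> \<le> exp (- w) * (q / exp 1) * (q * exp 1 + 1) powr (1 / q)"
      using stirling_ratio_le[of 1 q] stirling_ratio_pos[of q] q
      by (intro mult_left_mono powr_mono2) (auto simp: stirling_ratio_1)
    finally have 2: "r \<le> exp (- w) * (q / exp 1) * (q * exp 1 + 1) powr (1 / q)" .
    have "exp (- w / q) * (p / exp 1) \<le> C * (p / q) * (exp (- w) * (q / exp 1) * (q * exp 1 + 1) powr (1 / q))"
      using 1 lr mult_left_mono[OF 2, of "C * (p / q)"] C0 p q by auto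
    also have "\<dots> = C * exp (- w) * (q * exp 1 + 1) powr (1 / q) * (p / exp 1)" using q by simp
    finally have "exp (- w / q) \<le> C * exp (- w) * (q * exp 1 + 1) powr (1 / q)" using p q
      by (subst (asm) mult_le_cancel_right) auto
    then have "exp w * exp (- w / q) \<le> exp w * (C * exp (- w) * (q * exp 1 + 1) powr (1 / q))"
      by (intro mult_left_mono) auto
    then show ?thesis by (simp add: exp_minus exp_diff field_simps)
  qed
  have lim1: "((\<lambda>q. exp (w - w / q)) \<longlongrightarrow> exp w) at_top" by real_asymp
  have lim2: "((\<lambda>q. C * (q * exp 1 + 1) powr (1 / q)) \<longlongrightarrow> C) at_top" by real_asymp
  have "exp w \<le> C"
    by (rule tendsto_le[OF trivial_limit_at_top_linorder lim2 lim1])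
       (use bound in \<open>auto intro: eventually_at_top_linorderI[of 2]\<close>)
  then show ?thesis by (simp add: w)
qed

section \<open>Log-concave random variables\<close>


lemma log_concave_exp_neg:
  assumes V: "extended_convex V"
  shows "log_concave (\<lambda>x. enn2real (exp_neg (V x)))"
  unfolding log_concave_def
proof (intro conjI allI impI)
  fix x y t :: real assume t: "0 < t \<and> t < 1"
  let ?f = "\<lambda>x. enn2real (exp_neg (V x))" and ?z = "(1 - t) * x + t * y"
  have ninf: "V u \<noteq> - \<infinity>" for u using V by (simp add: extended_convex_def)
  show "?f x powr (1 - t) * ?f y powr t \<le> ?f ?z"
  proof (cases "V x = \<infinity> \<or> V y = \<infinity>")
    case True
    then show ?thesis by (auto simp: exp_neg_def)
  next
    case False
    then obtain r s where rs: "V x = ereal r" "V y = ereal s"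
      using ninf by (metis ereal_cases)
    have le: "V ?z \<le> ereal ((1 - t) * r + t * s)"
      using V t unfolding extended_convex_def by (metis less_imp_le rs plus_ereal.simps(1) times_ereal.simps(1))
    then obtain c where c: "V ?z = ereal c" using ninf[of ?z] by (cases "V ?z") auto
    have "exp (- r) powr (1 - t) * exp (- s) powr t = exp (- ((1 - t) * r + t * s))"
      unfolding exp_powr_real by (simp add: algebra_simps flip: exp_add)
    also have "\<dots> \<le> exp (- c)" using le c by simp
    finally show ?thesis by (simp add: rs c exp_neg_def)
  qed
qed simp

lemma nn_integral_abs_powr_split:
  fixes f :: "real \<Rightarrow> real"
  assumes [measurable]: "f \<in> borel_measurable borel"
  shows "(\<integral>\<^sup>+ x. ennreal (f x) * ennreal (\<bar>x\<bar> powr s) \<partial>lborel)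
    = (\<integral>\<^sup>+ x. ennreal (half_moment_fun f s x) \<partial>lborel)
      + (\<integral>\<^sup>+ x. ennreal (half_moment_fun (\<lambda>x. f (- x)) s x) \<partial>lborel)"
proof -
  have "(\<integral>\<^sup>+ x. ennreal (half_moment_fun (\<lambda>x. f (- x)) s x) \<partial>lborel)
      = (\<integral>\<^sup>+ x. ennreal (half_moment_fun (\<lambda>x. f (- x)) s (- x)) \<partial>lborel)"
    by (subst nn_integral_real_affine[where c = "- 1" and t = 0]) auto
  then have "(\<integral>\<^sup>+ x. ennreal (half_moment_fun f s x) \<partial>lborel)
      + (\<integral>\<^sup>+ x. ennreal (half_moment_fun (\<lambda>x. f (- x)) s x) \<partial>lborel)
    = (\<integral>\<^sup>+ x. ennreal (half_moment_fun f s x) + ennreal (half_moment_fun (\<lambda>x. f (- x)) s (- x)) \<partial>lborel)"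
    by (simp add: nn_integral_add)
  also have "\<dots> = (\<integral>\<^sup>+ x. ennreal (f x) * ennreal (\<bar>x\<bar> powr s) \<partial>lborel)"
    by (rule nn_integral_cong_AE, rule AE_mp[OF AE_lborel_singleton[of 0]])
       (auto simp: half_moment_fun_def indicator_def mult.commute ennreal_mult'')
  finally show ?thesis ..
qed

lemma integrable_half_moment_fun:
  fixes f :: "real \<Rightarrow> real"
  assumes f: "\<And>x. f x \<ge> 0" "f \<in> borel_measurable borel"
    and fin: "(\<integral>\<^sup>+ x. ennreal (f x) * ennreal (\<bar>x\<bar> powr s) \<partial>lborel) < \<infinity>"
  shows "integrable lborel (half_moment_fun f s)" "integrable lborel (half_moment_fun (\<lambda>x. f (- x)) s)"
proof -
  have "half_moment_fun f s x \<ge> 0" "half_moment_fun (\<lambda>x. f (- x)) s x \<ge> 0" for x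
    using f(1) by (auto simp: half_moment_fun_def)
  moreover have "half_moment_fun f s \<in> borel_measurable lborel"
    "half_moment_fun (\<lambda>x. f (- x)) s \<in> borel_measurable lborel"
    using f(2) by auto
  ultimately show "integrable lborel (half_moment_fun f s)" "integrable lborel (half_moment_fun (\<lambda>x. f (- x)) s)"
    using fin unfolding nn_integral_abs_powr_split[OF f(2)]
    by (auto intro!: integrableI_nonneg)
qed

lemma nn_integral_abs_powr_eq:
  fixes f :: "real \<Rightarrow> real"
  assumes f: "\<And>x. f x \<ge> 0" "f \<in> borel_measurable borel"
    and I: "integrable lborel (half_moment_fun f s)" "integrable lborel (half_moment_fun (\<lambda>x. f (- x)) s)"
  shows "(\<integral>\<^sup>+ x. ennreal (f x) * ennreal (\<bar>x\<bar> powr s) \<partial>lborel)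
    = ennreal (half_moment f s + half_moment (\<lambda>x. f (- x)) s)"
proof -
  have nn: "half_moment_fun f s x \<ge> 0" "half_moment_fun (\<lambda>x. f (- x)) s x \<ge> 0" for x
    using f(1) by (auto simp: half_moment_fun_def)
  then have "half_moment f s \<ge> 0" "half_moment (\<lambda>x. f (- x)) s \<ge> 0"
    by (auto simp: half_moment_def)
  then show ?thesis
    unfolding nn_integral_abs_powr_split[OF f(2)]
    by (simp add: nn_integral_eq_integral I nn half_moment_def)
qed

lemma L_norm_comparison:
  assumes M: "prob_space M" and X: "log_concave_rv M X" and q: "q \<ge> 2" "q < p"
  shows "L_norm M p X \<le> ereal (C0 * (p / q)) * L_norm M q X"
proof -
  interpret prob_space M by (rule M)
  have "C0 > 1" using C0_eq_exp by (metis one_less_exp_iff)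
  have Cpq: "C0 * (p / q) > 1" using \<open>C0 > 1\<close> q by (intro less_1_mult) auto
  have [measurable]: "X \<in> borel_measurable M" using X by (simp add: log_concave_rv_def)
  consider c where "AE \<omega> in M. X \<omega> = c"
    | V where "extended_convex V" "distributed M lborel X (\<lambda>x. exp_neg (V x))"
    using X by (auto simp: log_concave_rv_def)
  then show ?thesis
  proof cases
    case 1
    have "L_norm M s X = ereal \<bar>c\<bar>" if "s > 0" for s
    proof -
      have "(\<integral>\<^sup>+ \<omega>. ennreal (\<bar>X \<omega>\<bar> powr s) \<partial>M) = (\<integral>\<^sup>+ \<omega>. ennreal (\<bar>c\<bar> powr s) \<partial>M)"
        using 1 by (intro nn_integral_cong_AE) auto
      also have "\<dots> = ennreal (\<bar>c\<bar> powr s)" by (simp add: emeasure_space_1)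
      finally show ?thesis using that by (simp add: L_norm_def powr_powr)
    qed
    moreover have "1 * \<bar>c\<bar> \<le> C0 * (p / q) * \<bar>c\<bar>" using Cpq by (intro mult_right_mono) auto
    ultimately show ?thesis using q by simp
  next
    case 2
    define f where "f = (\<lambda>x. enn2real (exp_neg (V x)))"
    have ennf: "exp_neg (V x) = ennreal (f x)" for x by (simp add: f_def exp_neg_def)
    have [measurable]: "(\<lambda>x. exp_neg (V x)) \<in> borel_measurable borel"
      using distributed_borel_measurable[OF 2(2)] by simp
    have fm[measurable]: "f \<in> borel_measurable borel" unfolding f_def by measurable
    have f: "log_concave f" unfolding f_def by (rule log_concave_exp_neg[OF 2(1)])
    have nonneg: "f x \<ge> 0" for x by (simp add: f_def)
    have moment: "(\<integral>\<^sup>+ \<omega>. ennreal (\<bar>X \<omega>\<bar> powr s) \<partial>M)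
        = (\<integral>\<^sup>+ x. ennreal (f x) * ennreal (\<bar>x\<bar> powr s) \<partial>lborel)" for s
      using distributed_nn_integral[OF 2(2), of "\<lambda>x. ennreal (\<bar>x\<bar> powr s)"] by (simp add: ennf)
    \<comment> \<open>Because \<open>0 powr 0 = 0\<close>, the weight of order 0 differs from 1 at
      the origin, a null set.\<close>
    have "(\<integral>\<^sup>+ x. ennreal (f x) * ennreal (\<bar>x\<bar> powr 0) \<partial>lborel) = (\<integral>\<^sup>+ x. ennreal (f x) * 1 \<partial>lborel)"
      by (rule nn_integral_cong_AE, rule AE_mp[OF AE_lborel_singleton[of 0]]) auto
    also have "\<dots> = 1"
      using distributed_nn_integral[OF 2(2), of "\<lambda>_. 1"] by (simp add: ennf emeasure_space_1)
    finally have total: "(\<integral>\<^sup>+ x. ennreal (f x) * ennreal (\<bar>x\<bar> powr 0) \<partial>lborel) = 1" .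
    have I0: "integrable lborel (half_moment_fun f 0)" "integrable lborel (half_moment_fun (\<lambda>x. f (- x)) 0)"
      using integrable_half_moment_fun[OF nonneg fm, of 0] unfolding total by auto
    have prob: "half_moment f 0 + half_moment (\<lambda>x. f (- x)) 0 = 1"
      using total unfolding nn_integral_abs_powr_eq[OF nonneg fm I0] by (simp add: ennreal_eq_1)
    show ?thesis
    proof (cases "(\<integral>\<^sup>+ \<omega>. ennreal (\<bar>X \<omega>\<bar> powr q) \<partial>M) = \<infinity>")
      \<comment> \<open>Finiteness of the q-th moment need not be proved: otherwise the right-hand
        side is \<infinity>.\<close>
      case True
      then have top: "ereal (C0 * (p / q)) * L_norm M q X = \<infinity>"
        using \<open>C0 > 1\<close> q by (simp add: L_norm_def)
      show ?thesis unfolding top by simp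
    next
      case False
      then have "(\<integral>\<^sup>+ x. ennreal (f x) * ennreal (\<bar>x\<bar> powr q) \<partial>lborel) < \<infinity>"
        unfolding moment by (simp add: less_top)
      note Iq = integrable_half_moment_fun[OF nonneg fm this]
      have q0: "0 < q" using q by simp
      note Ip = half_line_moment_le(1)[OF f fm I0(1) Iq(1) q0 q(2)]
        half_line_moment_le(1)[OF log_concave_reflect[OF f] _ I0(2) Iq(2) q0 q(2)]
      define A where "A s = half_moment f s + half_moment (\<lambda>x. f (- x)) s" for s
      have A0: "A s \<ge> 0" for s
        unfolding A_def half_moment_def half_moment_fun_def using nonneg
        by (intro add_nonneg_nonneg Bochner_Integration.integral_nonneg) auto
      have norm: "L_norm M s X = ereal (A s powr (1 / s))"
        if "integrable lborel (half_moment_fun f s)" "integrable lborel (half_moment_fun (\<lambda>x. f (- x)) s)" for s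
        using nn_integral_abs_powr_eq[OF nonneg fm that] A0[of s] moment[of s]
        by (simp add: L_norm_def A_def)
      have "A p \<le> (C0 * (p / q)) powr p * A q powr (p / q)"
        unfolding A_def by (rule abs_moment_le[OF f fm I0 Iq prob q])
      then have "A p powr (1 / p) \<le> ((C0 * (p / q)) powr p * A q powr (p / q)) powr (1 / p)"
        using A0 q by (intro powr_mono2) auto
      also have "\<dots> = C0 * (p / q) * A q powr (1 / q)"
        using q Cpq unfolding powr_mult[of "(C0 * (p / q)) powr p"] by (simp add: powr_powr)
      finally show ?thesis using norm Ip Iq by simp
    qed
  qed
qed

text \<open>The competitor C is tested only on probability measures over the reals. This is a weaker
  demand than on all spaces, so minimality is the stronger for it; the shifted exponentials live
  there.\<close>

theorem theorem1p4:
  shows "(\<forall>(M :: 'a measure) (X :: 'a \<Rightarrow> real) (p :: real) (q :: real).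
            prob_space M \<and> log_concave_rv M X \<and> p > q \<and> q \<ge> 2 \<longrightarrow>
            L_norm M p X \<le> ereal (C0 * (p / q)) * L_norm M q X) \<and>
         (\<forall>C :: real.
            (\<forall>(N :: real measure) (Y :: real \<Rightarrow> real) (p :: real) (q :: real).
               prob_space N \<and> log_concave_rv N Y \<and> p > q \<and> q \<ge> 2 \<longrightarrow>
               L_norm N p Y \<le> ereal (C * (p / q)) * L_norm N q Y) \<longrightarrow>
            C \<ge> C0)"
  using L_norm_comparison C0_le by blast

end
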